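(* Let $k\in\{0,1,2,\dots\}$, $\lambda>0$, $\rho\in\mathbb{C}$ and $\psi,\phi\in(0,\pi)$. Then $$ \int_{-\infty}^\infty e^\rho\ {}_1F_1\!\left(\begin{matrix}\lambda+ix\\ 2\lambda\end{matrix};(e^{-2i\phi}-1)\rho\right)e^{(2\psi-\pi)x}\,|\Gamma(\lambda+ix)|^2\,P_k^{(\lambda)}(x;\psi)\,dx $$ $$ =\exp\!\left(\frac{\rho\,e^{-i\phi}\sin(\psi-\phi)}{\sin\psi}\right)\left(\frac{\sin\phi}{\sin\psi}\right)^k\frac{2\pi\,\Gamma(2\lambda)\,\rho^k}{e^{ik\phi}\,(2\sin\psi)^{2\lambda}\,k!}. $$
   Context: The Pochhammer symbol is $(z)_n=\prod_{i=1}^n(z+i-1)$ (so $(z)_0=1$), and ${}_pF_q(a_1,\dots,a_p;b_1,\dots,b_q;z)=\sum_{n\ge0}\frac{(a_1)_n\cdots(a_p)_n}{(b_1)_n\cdots(b_q)_n}\frac{z^n}{n!}$. The Meixner-Pollaczek polynomials are $$P_n^{(\lambda)}(x;\phi)=\frac{(2\lambda)_n}{n!}e^{in\phi}\ {}_2F_1\!\left(\begin{matrix}-n,\ \lambda+ix\\ 2\lambda\end{matrix};1-e^{-2i\phi}\right).$$ *)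

theory Defs
  imports "HOL-Analysis.Analysis"
begin

text \<open>The lists \<open>as\<close> and \<open>bs\<close> hold the numerator and denominator parameters. The series is read
  as usual: it is meaningful when no denominator parameter is a nonpositive integer and the
  series converges (in particular when it terminates, because a numerator parameter
  is a nonpositive integer).\<close>

definition hypergeom :: "complex list \<Rightarrow> complex list \<Rightarrow> complex \<Rightarrow> complex" where
  "hypergeom as bs z =
     (\<Sum>n. (\<Prod>a\<leftarrow>as. pochhammer a n) / (\<Prod>b\<leftarrow>bs. pochhammer b n) * (z ^ n / fact n))"

definition meixner_pollaczek :: "nat \<Rightarrow> real \<Rightarrow> complex \<Rightarrow> real \<Rightarrow> complex" where
  "meixner_pollaczek n l x \<phi> =
     pochhammer (2 * of_real l) n / fact n * exp (\<i> * of_nat n * of_real \<phi>) *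
     hypergeom [- of_nat n, of_real l + \<i> * x] [2 * of_real l] (1 - exp (- 2 * \<i> * of_real \<phi>))"

text \<open>The relation to the library's formal hypergeometric series:\<close>

lemma foldl_times_eq_prod_list:
  fixes f :: "'a \<Rightarrow> 'b::comm_monoid_mult"
  shows "foldl (\<lambda>r a. r * f a) c as = c * (\<Prod>a\<leftarrow>as. f a)"
  by (induction as arbitrary: c) (simp_all add: mult.assoc)

lemma hypergeom_eq_eval_fps: "hypergeom as bs z = eval_fps (fps_hypergeo as bs 1) z"
  by (simp add: hypergeom_def eval_fps_def fps_hypergeo_nth foldl_times_eq_prod_list)

end

theory Submission
  imports Defs "HOL-Probability.Characteristic_Functions" "HOL-Probability.Sinc_Integral"
    "HOL-Complex_Analysis.Conformal_Mappings"
begin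

text \<open>
  The basic integral is \<open>\<integral> \<Gamma>(a + ix) \<Gamma>(b - ix) e\<^bsup>(2\<psi> - \<pi>)x\<^esup> dx\<close>. On the line
  \<open>Re \<psi> = \<pi>/2\<close> it is evaluated by Fourier inversion, because \<open>x \<mapsto> \<Gamma>(a + ix)\<close> is the Fourier
  transform of \<open>u \<mapsto> exp (a u - e\<^bsup>u\<^esup>)\<close>; the exponential decay of the Gamma function on vertical lines
  makes both sides holomorphic in \<open>\<psi>\<close> on the strip \<open>0 < Re \<psi> < \<pi>\<close>, so they agree there.
  Kummer's transformation turns the \<open>\<^sub>1F\<^sub>1\<close> factor into a series in \<open>(\<lambda> - ix)\<^sub>n\<close>, while the
  polynomial is a combination of the \<open>(\<lambda> + ix)\<^sub>j\<close>; multiplied with \<open>|\<Gamma>(\<lambda> + ix)|\<^sup>2\<close>, these only shift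
  \<open>a\<close> and \<open>b\<close>. By the Chu-Vandermonde sum, the sum over \<open>j\<close> of the \<open>n\<close>-th terms is a multiple
  of \<open>(-n)\<^sub>k y\<^bsup>n\<^esup> / n!\<close>, and summation over \<open>n\<close> gives \<open>(-y)\<^bsup>k\<^esup> e\<^bsup>y\<^esup>\<close>.
\<close>

section \<open>Fourier inversion\<close>

text \<open>Substituting y = \<epsilon> x leads to the characteristic function of the standard
  normal law, a Gaussian again. As a function of s, the right side is \<open>sqrt (2 * pi)\<close>
  times an approximate identity as \<epsilon> tends to 0.\<close>

lemma integral_gaussian_iexp:
  fixes s \<epsilon> :: real
  assumes "\<epsilon> > 0"
  shows "(LINT x|lborel. iexp (s * x) * of_real (std_normal_density (\<epsilon> * x)))
    = of_real (sqrt (2 * pi) / \<epsilon> * std_normal_density (s / \<epsilon>))"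
proof -
  have "(LINT x|lborel. iexp (s * x) * of_real (std_normal_density (\<epsilon> * x)))
      = \<bar>1/\<epsilon>\<bar> *\<^sub>R (LINT y|lborel. iexp (s * (0 + 1/\<epsilon> * y)) * of_real (std_normal_density (\<epsilon> * (0 + 1/\<epsilon> * y))))"
    using assms by (intro lborel_integral_real_affine) auto
  also have "(LINT y|lborel. iexp (s * (0 + 1/\<epsilon> * y)) * of_real (std_normal_density (\<epsilon> * (0 + 1/\<epsilon> * y))))
      = (LINT y|lborel. std_normal_density y *\<^sub>R iexp (s / \<epsilon> * y))"
    using assms by (intro Bochner_Integration.integral_cong) (auto simp: scaleR_conv_of_real mult.commute)
  also have "\<dots> = char std_normal_distribution (s / \<epsilon>)"
    unfolding char_def by (subst integral_density) auto
  also have "\<dots> = of_real (sqrt (2 * pi) * std_normal_density (s / \<epsilon>))"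
    unfolding char_std_normal_distribution by (simp add: std_normal_density_def)
  finally show ?thesis
    using assms by (simp add: scaleR_conv_of_real)
qed

lemma integrable_product_mult:
  fixes f g :: "real \<Rightarrow> 'a :: {real_normed_field, banach, second_countable_topology}"
  assumes [simp]: "integrable lborel f" "integrable lborel g"
  shows "integrable (lborel \<Otimes>\<^sub>M lborel) (\<lambda>(x, y). f x * g y)"
proof -
  have [measurable]: "f \<in> borel_measurable borel" "g \<in> borel_measurable borel"
    using assms[THEN borel_measurable_integrable] by auto
  show ?thesis
    by (intro lborel_pair.Fubini_integrable) (auto simp: norm_mult)
qed

text \<open>Serves as the hypothesis of Fubini: in both exchanges of integrals below, the integrand
  is a product of two integrable functions times a factor of modulus 1.\<close>

lemma integrable_product_dominated:
  fixes h :: "real \<Rightarrow> real \<Rightarrow> 'a :: {real_normed_field, banach, second_countable_topology}"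
    and f g :: "real \<Rightarrow> 'a"
  assumes "integrable lborel f" "integrable lborel g"
    and "case_prod h \<in> borel_measurable (lborel \<Otimes>\<^sub>M lborel)"
    and "\<And>x y. norm (h x y) \<le> norm (f x * g y)"
  shows "integrable (lborel \<Otimes>\<^sub>M lborel) (case_prod h)"
  by (rule Bochner_Integration.integrable_bound[OF integrable_product_mult[OF assms(1,2)] assms(3)])
     (use assms(4) in auto)

lemma std_normal_density_le: "std_normal_density x \<le> 1 / sqrt (2 * pi)"
  by (simp add: std_normal_density_def divide_right_mono)

text \<open>Damping the outer integral by the Gaussian \<open>x \<mapsto> std_normal_density (\<epsilon> x)\<close> justifies the
  exchange of integrals; it turns into convolution with an approximate identity.\<close>

lemma fourier_inversion:
  fixes g :: "real \<Rightarrow> complex" and v :: real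
  defines "F \<equiv> \<lambda>x. LINT u|lborel. g u * iexp (u * x)"
  assumes g: "integrable lborel g" and cont: "continuous_on UNIV g" and bound: "\<And>u. norm (g u) \<le> B"
    and F: "integrable lborel F"
  shows "(LINT x|lborel. F x * iexp (- (v * x))) = 2 * of_real pi * g v"
proof -
  have [measurable]: "g \<in> borel_measurable borel"
    using g by auto
  have [measurable]: "F \<in> borel_measurable borel"
    using F by auto
  define \<epsilon> :: "nat \<Rightarrow> real" where "\<epsilon> m = 1 / real (Suc m)" for m
  have \<epsilon>: "\<epsilon> m > 0" for m by (simp add: \<epsilon>_def)
  have \<epsilon>0: "\<epsilon> \<longlonglongrightarrow> 0" unfolding \<epsilon>_def by (rule LIMSEQ_Suc[OF lim_1_over_n])
  let ?L = "\<lambda>m. LINT x|lborel. F x * iexp (- (v * x)) * of_real (std_normal_density (\<epsilon> m * x))"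
  have cd: "isCont std_normal_density x" for x
    unfolding std_normal_density_def by (intro continuous_intros) auto
  \<comment> \<open>First limit of \<open>?L\<close>: the damping factor tends to its value 1 / sqrt
    (2 pi) at 0.\<close>
  have "?L \<longlonglongrightarrow> (LINT x|lborel. F x * iexp (- (v * x)) * of_real (std_normal_density 0))"
  proof (rule integral_dominated_convergence[where w = "\<lambda>x. norm (F x) * (1 / sqrt (2 * pi))"])
    show "AE x in lborel. (\<lambda>m. F x * iexp (- (v * x)) * of_real (std_normal_density (\<epsilon> m * x)))
        \<longlonglongrightarrow> F x * iexp (- (v * x)) * of_real (std_normal_density 0)"
    proof (rule AE_I2)
      fix x :: real
      have "(\<lambda>m. \<epsilon> m * x) \<longlonglongrightarrow> 0" using tendsto_mult_right[OF \<epsilon>0, of x] by simp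
      thus "(\<lambda>m. F x * iexp (- (v * x)) * of_real (std_normal_density (\<epsilon> m * x)))
        \<longlonglongrightarrow> F x * iexp (- (v * x)) * of_real (std_normal_density 0)"
        by (intro tendsto_intros isCont_tendsto_compose[OF cd])
    qed
    show "AE x in lborel. norm (F x * iexp (- (v * x)) * of_real (std_normal_density (\<epsilon> m * x)))
        \<le> norm (F x) * (1 / sqrt (2 * pi))" for m
      using mult_left_mono[OF std_normal_density_le, of "norm (F x)" "\<epsilon> m * x" for x]
      by (auto simp: norm_mult)
  qed (use F in auto)
  \<comment> \<open>Exchanging the integrals and substituting u = v + \<epsilon> y turns the damped
    integral into a Gaussian average of g around v, which gives the second limit.\<close>
  moreover have "?L m = of_real (sqrt (2 * pi)) * (LINT y|lborel. of_real (std_normal_density y) * g (v + \<epsilon> m * y))" for m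
  proof -
    have gi: "integrable lborel (\<lambda>x. complex_of_real (std_normal_density (\<epsilon> m * x)))"
      using lborel_integrable_real_affine[of std_normal_density "\<epsilon> m" 0] \<epsilon>[of m]
      by simp
    have "?L m = (LINT x|lborel. LINT u|lborel. g u * iexp ((u - v) * x) * of_real (std_normal_density (\<epsilon> m * x)))"
      unfolding F_def
      by (intro Bochner_Integration.integral_cong refl, simp flip: integral_mult_left_zero)
         (intro Bochner_Integration.integral_cong refl, simp add: ring_distribs exp_diff exp_minus field_simps)
    also have "\<dots> = (LINT u|lborel. LINT x|lborel. g u * iexp ((u - v) * x) * of_real (std_normal_density (\<epsilon> m * x)))"
      by (rule lborel_pair.Fubini_integral, rule integrable_product_dominated[OF g gi])
         (auto simp: norm_mult simp del: of_real_mult of_real_diff)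
    also have "\<dots> = (LINT u|lborel. g u * of_real (sqrt (2 * pi) / \<epsilon> m * std_normal_density ((u - v) / \<epsilon> m)))"
      by (intro Bochner_Integration.integral_cong refl)
         (simp only: mult.assoc integral_mult_right_zero integral_gaussian_iexp[OF \<epsilon>])
    also have "\<dots> = \<bar>\<epsilon> m\<bar> *\<^sub>R (LINT y|lborel. g (v + \<epsilon> m * y) *
        of_real (sqrt (2 * pi) / \<epsilon> m * std_normal_density ((v + \<epsilon> m * y - v) / \<epsilon> m)))"
      using \<epsilon>[of m] by (intro lborel_integral_real_affine) auto
    also have "\<dots> = of_real (\<epsilon> m) * (LINT y|lborel. of_real (sqrt (2 * pi) / \<epsilon> m) * (of_real (std_normal_density y) * g (v + \<epsilon> m * y)))"
      using \<epsilon>[of m] by (simp add: scaleR_conv_of_real mult_ac)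
    also have "\<dots> = of_real (sqrt (2 * pi)) * (LINT y|lborel. of_real (std_normal_density y) * g (v + \<epsilon> m * y))"
      using \<epsilon>[of m] by (simp only: integral_mult_right_zero) simp
    finally show ?thesis .
  qed
  moreover have "(\<lambda>m. LINT y|lborel. of_real (std_normal_density y) * g (v + \<epsilon> m * y))
      \<longlonglongrightarrow> (LINT y|lborel. of_real (std_normal_density y) * g v)"
  proof (rule integral_dominated_convergence[where w = "\<lambda>y. std_normal_density y * B"])
    show "AE y in lborel. (\<lambda>m. of_real (std_normal_density y) * g (v + \<epsilon> m * y))
        \<longlonglongrightarrow> of_real (std_normal_density y) * g v"
    proof (rule AE_I2)
      fix y :: real
      have *: "(\<lambda>m. v + \<epsilon> m * y) \<longlonglongrightarrow> v"
        using tendsto_add[OF tendsto_const tendsto_mult_right[OF \<epsilon>0, of y], of v] by simp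
      have "isCont g v" using cont by (simp add: continuous_on_eq_continuous_at)
      from isCont_tendsto_compose[OF this *]
      show "(\<lambda>m. of_real (std_normal_density y) * g (v + \<epsilon> m * y)) \<longlonglongrightarrow> of_real (std_normal_density y) * g v"
        by (intro tendsto_intros)
    qed
  qed (use bound in \<open>auto simp: norm_mult intro!: mult_left_mono\<close>)
  moreover have "(LINT y|lborel. of_real (std_normal_density y) * g v) = g v"
    by (simp add: mult.commute)
  \<comment> \<open>In the comparison of the two limits, one side is divided by sqrt (2 pi) and the
    other multiplied by it; this produces the factor 2 pi.\<close>
  ultimately have "(LINT x|lborel. F x * iexp (- (v * x)) * of_real (std_normal_density 0))
      = of_real (sqrt (2 * pi)) * g v"
    by (intro LIMSEQ_unique[where X = ?L]) (simp_all add: tendsto_mult_left)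
  also have "(LINT x|lborel. F x * iexp (- (v * x)) * of_real (std_normal_density 0))
      = (LINT x|lborel. F x * iexp (- (v * x))) / of_real (sqrt (2 * pi))"
    by (subst integral_mult_left_zero) (simp add: std_normal_density_def)
  finally have "(LINT x|lborel. F x * iexp (- (v * x))) = of_real (sqrt (2 * pi) * sqrt (2 * pi)) * g v"
    by (simp add: field_simps del: real_sqrt_mult_self)
  thus ?thesis by simp
qed

section \<open>The Gamma function on vertical lines\<close>

text \<open>Substituting t = exp u in Euler's integral turns t^(z - 1) dt into exp (z u) du.\<close>

lemma Gamma_fourier:
  fixes a x :: real
  assumes "a > 0"
  shows "has_bochner_integral lborel (\<lambda>u. of_real (exp (a * u - exp u)) * iexp (u * x)) (Gamma (of_real a + \<i> * of_real x))"
proof -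
  define z where "z = of_real a + \<i> * of_real x"
  have z: "Re z > 0" using assms by (simp add: z_def)
  let ?f = "\<lambda>t. complex_of_real t powr (z - 1) / of_real (exp t)"
  let ?h = "\<lambda>u::real. complex_of_real (exp (a * u - exp u)) * iexp (u * x)"
  have *: "\<bar>exp u\<bar> *\<^sub>R ?f (exp u) = ?h u" for u :: real
  proof -
    have "complex_of_real (exp u) powr (z - 1) = exp ((z - 1) * of_real u)"
      by (simp add: powr_def Ln_of_real)
    thus ?thesis
      by (simp add: scaleR_conv_of_real z_def algebra_simps flip: exp_of_real exp_add exp_diff)
  qed
  have r: "range (exp :: real \<Rightarrow> real) = {0<..}"
    by (auto simp: image_iff intro!: exI[of _ "ln _"] exp_ln[symmetric])
  have ai: "?f absolutely_integrable_on {0<..}"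
    using absolutely_integrable_Gamma_integral[OF z, of 1] by simp
  have "(?f has_integral Gamma z) {0..}"
    by (rule Gamma_integral_complex[OF z])
  \<comment> \<open>The endpoint 0 is removed as a null set, because exp maps the line onto the open
    half-line.\<close>
  hence "(?f has_integral Gamma z) {0<..}"
    by (subst has_integral_spike_set_eq[of _ "{0..}"]) (auto intro: negligible_subset[of "{0}"])
  hence "integral {0<..} ?f = Gamma z" by (rule integral_unique)
  with ai have "(\<lambda>u. \<bar>exp u\<bar> *\<^sub>R ?f (exp u)) absolutely_integrable_on UNIV \<and> integral UNIV (\<lambda>u. \<bar>exp u\<bar> *\<^sub>R ?f (exp u)) = Gamma z"
    by (subst has_absolute_integral_change_of_variables_real)
       (auto simp: r inj_on_def intro!: derivative_eq_intros)
  hence h: "?h absolutely_integrable_on UNIV" "integral UNIV ?h = Gamma z"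
    unfolding * by auto
  have m: "?h \<in> borel_measurable borel" by measurable
  have "integrable lebesgue ?h" using h(1) by (simp add: set_integrable_def)
  hence i: "integrable lborel ?h" using m by (simp add: integrable_completion)
  moreover have "integral\<^sup>L lborel ?h = Gamma z"
    using integral_lborel[OF i] h(2) by simp
  ultimately show ?thesis by (simp add: has_bochner_integral_iff z_def)
qed

text \<open>The quotient is 1 / |1 + ix/a|, the kind of factor that occurs in the product formula
  for |Gamma(a + ix)| / Gamma(a).\<close>

lemma divide_norm_add_imag_mono:
  fixes a b x :: real
  assumes "0 < a" "a \<le> b"
  shows "b / cmod (of_real b + \<i> * of_real x) \<ge> a / cmod (of_real a + \<i> * of_real x)"
proof -
  have "a * sqrt (b\<^sup>2 + x\<^sup>2) \<le> b * sqrt (a\<^sup>2 + x\<^sup>2)"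
  proof (rule power2_le_imp_le)
    have "a\<^sup>2 * x\<^sup>2 \<le> b\<^sup>2 * x\<^sup>2" using assms by (intro mult_right_mono power_mono) auto
    thus "(a * sqrt (b\<^sup>2 + x\<^sup>2))\<^sup>2 \<le> (b * sqrt (a\<^sup>2 + x\<^sup>2))\<^sup>2"
      by (simp add: power_mult_distrib algebra_simps)
  qed (use assms in auto)
  moreover have "sqrt (b\<^sup>2 + x\<^sup>2) > 0" "sqrt (a\<^sup>2 + x\<^sup>2) > 0"
    using assms by (auto intro: add_pos_nonneg)
  ultimately show ?thesis
    by (simp add: cmod_def field_simps)
qed

text \<open>Monotonicity reduces the decay of \<open>\<Gamma>(a + ix)\<close> to half-integers \<open>a\<close>, where the reflection
  formula applies.\<close>

lemma norm_Gamma_ratio_mono: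
  fixes a b x :: real
  assumes a: "0 < a" and ab: "a \<le> b"
  shows "cmod (Gamma (of_real a + \<i> * of_real x)) / Gamma a \<le> cmod (Gamma (of_real b + \<i> * of_real x)) / Gamma b"
proof -
  let ?z = "\<lambda>a. complex_of_real a + \<i> * of_real x"
  \<comment> \<open>Since |n^(c + ix)| = n^c, the factors n! n^c of the limit formula cancel. Only a
    product of quotients remains, each nondecreasing in c.\<close>
  have *: "cmod (Gamma_series (?z c) n) / Gamma_series c n = (\<Prod>k\<le>n. (c + of_nat k) / cmod (?z (c + of_nat k)))"
    if c: "c > 0" and n: "n > 0" for c n
  proof -
    have "?z c + of_nat k = ?z (c + of_nat k)" for k by simp
    hence "cmod (pochhammer (?z c) (n + 1)) = (\<Prod>k\<le>n. cmod (?z (c + of_nat k)))"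
      by (simp only: pochhammer_Suc_prod Suc_eq_plus1[symmetric] prod_norm[symmetric] atMost_atLeast0)
    moreover have "pochhammer c (n + 1) = (\<Prod>k\<le>n. c + of_nat k)"
      by (simp only: pochhammer_Suc_prod Suc_eq_plus1[symmetric] atMost_atLeast0)
    moreover have "cmod (exp (?z c * of_real (ln (of_nat n)))) = exp (c * ln (of_nat n))"
      by simp
    ultimately show ?thesis using c n
      by (simp add: Gamma_series_def norm_divide norm_mult prod_dividef del: norm_exp_eq_Re)
  qed
  have lim: "(\<lambda>n. cmod (Gamma_series (?z c) n) / Gamma_series c n) \<longlonglongrightarrow> cmod (Gamma (?z c)) / Gamma c" if "c > 0" for c
    using Gamma_real_pos[OF that] by (intro tendsto_intros) auto
  show ?thesis
  proof (rule tendsto_le[OF _ lim lim])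
    show "\<forall>\<^sub>F n in sequentially. cmod (Gamma_series (?z a) n) / Gamma_series a n \<le> cmod (Gamma_series (?z b) n) / Gamma_series b n"
      using eventually_gt_at_top[of 0]
    proof eventually_elim
      case (elim n)
      show ?case
        unfolding *[OF a elim] using a ab elim
        by (subst *) (auto intro!: prod_mono divide_norm_add_imag_mono simp del: of_real_add)
    qed
  qed (use a ab in auto)
qed

text \<open>Absorbs the linear factor from Gamma(z + 1) = z Gamma(z) at the cost of an arbitrarily
  small part d of the decay rate.\<close>

lemma abs_mult_exp_minus_bounded:
  fixes b d :: real
  assumes "d > 0" "b \<ge> 0"
  shows "(b + \<bar>x\<bar>) * exp (- d * \<bar>x\<bar>) \<le> b + 1 / d"
proof -
  have "d * \<bar>x\<bar> \<le> exp (d * \<bar>x\<bar>)" using exp_ge_add_one_self[of "d * \<bar>x\<bar>"] by linarith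
  hence "\<bar>x\<bar> * exp (- d * \<bar>x\<bar>) \<le> 1 / d"
    using assms by (simp add: exp_minus field_simps)
  moreover have "b * exp (- d * \<bar>x\<bar>) \<le> b * 1"
    using assms by (intro mult_left_mono) auto
  ultimately show ?thesis by (simp add: algebra_simps)
qed

lemma norm_Gamma_half:
  "(cmod (Gamma (1/2 + \<i> * of_real x)))\<^sup>2 = pi / cosh (pi * x)"
proof -
  have "Gamma (1/2 + \<i> * of_real x) * cnj (Gamma (1/2 + \<i> * of_real x)) = Gamma (1/2 + \<i> * of_real x) * Gamma (1 - (1/2 + \<i> * of_real x))"
    by (simp add: cnj_Gamma)
  also have "\<dots> = of_real pi / sin (of_real pi * (1/2 + \<i> * of_real x))"
    by (rule Gamma_reflection_complex)
  also have "sin (of_real pi * (1/2 + \<i> * of_real x)) = cos (\<i> * of_real (pi * x))"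
    by (simp add: algebra_simps sin_add flip: sin_of_real cos_of_real)
  also have "\<dots> = of_real (cosh (pi * x))"
    by (simp add: cos_conv_cosh cosh_field_def exp_minus flip: exp_of_real)
  finally have "of_real ((cmod (Gamma (1/2 + \<i> * of_real x)))\<^sup>2) = complex_of_real (pi / cosh (pi * x))"
    by (simp only: complex_norm_square of_real_divide)
  thus ?thesis by (simp only: of_real_eq_iff)
qed

lemma norm_Gamma_exp_decay:
  fixes a c :: real
  assumes a: "a > 0" and c: "c < pi / 2"
  obtains C where "\<And>x. cmod (Gamma (of_real a + \<i> * of_real x)) \<le> C * exp (- c * \<bar>x\<bar>)"
proof -
  \<comment> \<open>Induction upwards from 1/2. The rate c stays arbitrary because each step applies
    the hypothesis with a larger rate c + d.\<close>
  have half: "\<exists>C. \<forall>x. cmod (Gamma (of_real (real m + 1/2) + \<i> * of_real x)) \<le> C * exp (- c * \<bar>x\<bar>)"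
    if "c < pi / 2" for m c
    using that
  proof (induction m arbitrary: c)
    case 0
    have "cmod (Gamma (1/2 + \<i> * of_real x)) \<le> sqrt (2 * pi) * exp (- c * \<bar>x\<bar>)" for x
    proof -
      have "exp (pi * \<bar>x\<bar>) / 2 \<le> cosh (pi * x)"
        by (cases "x \<ge> 0") (auto simp: cosh_def)
      hence "pi / cosh (pi * x) \<le> pi / (exp (pi * \<bar>x\<bar>) / 2)"
        by (intro divide_left_mono) (auto intro!: mult_pos_pos cosh_real_pos)
      also have "\<dots> = 2 * pi * exp (- pi * \<bar>x\<bar>)" by (simp add: exp_minus field_simps)
      also have "\<dots> \<le> 2 * pi * exp (- (2 * c) * \<bar>x\<bar>)"
        using mult_right_mono[of "2 * c" pi "\<bar>x\<bar>"] 0 by simp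
      also have "\<dots> = (sqrt (2 * pi) * exp (- c * \<bar>x\<bar>))\<^sup>2"
        by (simp only: power_mult_distrib exp_double[symmetric]) (simp add: mult.assoc)
      finally show ?thesis
        unfolding norm_Gamma_half[symmetric] by (rule power2_le_imp_le) simp
    qed
    thus ?case by auto
  next
    case (Suc m)
    \<comment> \<open>Half the gap between c and pi / 2, so that the rate c + d is still
      admissible.\<close>
    define d where "d = (pi / 2 - c) / 2"
    have d: "d > 0" "c + d < pi / 2" using Suc.prems by (auto simp: d_def field_simps)
    from Suc.IH[OF d(2)] obtain C where C: "\<And>x. cmod (Gamma (of_real (real m + 1/2) + \<i> * of_real x)) \<le> C * exp (- (c + d) * \<bar>x\<bar>)"
      by auto
    have C0: "C \<ge> 0" using order_trans[OF norm_ge_zero C[of 0]] by simp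
    have "cmod (Gamma (of_real (real (Suc m) + 1/2) + \<i> * of_real x)) \<le> ((real m + 1/2 + 1 / d) * C) * exp (- c * \<bar>x\<bar>)" for x
    proof -
      let ?z = "of_real (real m + 1/2) + \<i> * of_real x"
      have "?z \<notin> \<int>\<^sub>\<le>\<^sub>0" by (auto elim!: nonpos_Ints_cases simp: complex_eq_iff)
      from Gamma_plus1[OF this] have "Gamma (of_real (real (Suc m) + 1/2) + \<i> * of_real x) = ?z * Gamma ?z"
        by (simp add: algebra_simps)
      moreover have "cmod ?z \<le> (real m + 1/2) + \<bar>x\<bar>"
        by (rule order_trans[OF norm_triangle_ineq]) (simp add: norm_mult del: of_real_add)
      ultimately have "cmod (Gamma (of_real (real (Suc m) + 1/2) + \<i> * of_real x)) \<le> ((real m + 1/2) + \<bar>x\<bar>) * (C * exp (- (c + d) * \<bar>x\<bar>))"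
        using C[of x] by (simp only: norm_mult) (intro mult_mono, auto)
      also have "exp (- (c + d) * \<bar>x\<bar>) = exp (- d * \<bar>x\<bar>) * exp (- c * \<bar>x\<bar>)"
        by (simp add: algebra_simps flip: exp_add)
      also have "((real m + 1/2) + \<bar>x\<bar>) * (C * (exp (- d * \<bar>x\<bar>) * exp (- c * \<bar>x\<bar>)))
          = (((real m + 1/2) + \<bar>x\<bar>) * exp (- d * \<bar>x\<bar>)) * (C * exp (- c * \<bar>x\<bar>))"
        by (simp only: mult_ac)
      also have "\<dots> \<le> (real m + 1/2 + 1 / d) * (C * exp (- c * \<bar>x\<bar>))"
        using C0 d by (intro mult_right_mono abs_mult_exp_minus_bounded) auto
      finally show ?thesis by (simp add: mult_ac)
    qed
    thus ?case by blast
  qed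
  \<comment> \<open>By monotonicity, the half-integer m + 1/2 above a controls Gamma(a + ix) up to
    the constant \<open>?r\<close>.\<close>
  obtain m where m: "real m \<ge> a" using real_arch_simple by blast
  from half[OF c, of m] obtain C where C: "\<And>x. cmod (Gamma (of_real (real m + 1/2) + \<i> * of_real x)) \<le> C * exp (- c * \<bar>x\<bar>)"
    by auto
  let ?r = "Gamma a / Gamma (real m + 1/2)"
  have r: "Gamma a > 0" "Gamma (real m + 1/2) > 0" using a by (auto intro!: Gamma_real_pos)
  show ?thesis
  proof (rule that[of "?r * C"])
    fix x
    have "cmod (Gamma (of_real a + \<i> * of_real x)) \<le> ?r * cmod (Gamma (of_real (real m + 1/2) + \<i> * of_real x))"
      using norm_Gamma_ratio_mono[of a "real m + 1/2" x] a m r by (simp add: field_simps)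
    also have "\<dots> \<le> ?r * (C * exp (- c * \<bar>x\<bar>))"
      using r by (intro mult_left_mono C) auto
    finally show "cmod (Gamma (of_real a + \<i> * of_real x)) \<le> ?r * C * exp (- c * \<bar>x\<bar>)" by simp
  qed
qed

section \<open>Termwise integration and holomorphy of two-sided Laplace integrals\<close>

lemma
  fixes f :: "nat \<Rightarrow> 'a \<Rightarrow> 'b :: {banach, second_countable_topology}"
  assumes f: "\<And>n. f n \<in> borel_measurable M" and w: "integrable M w"
    and bound: "\<And>N x. (\<Sum>n<N. norm (f n x)) \<le> w x" and sums: "\<And>x. (\<lambda>n. f n x) sums g x"
  shows integrable_sums_dominated: "integrable M g"
    and integral_sums_dominated: "(\<lambda>n. integral\<^sup>L M (f n)) sums integral\<^sup>L M g"
proof -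
  have bound': "norm (\<Sum>n<N. f n x) \<le> w x" for N x
    using norm_sum bound by (rule order_trans)
  have g: "g \<in> borel_measurable M"
    by (rule borel_measurable_LIMSEQ_metric[where f = "\<lambda>N x. \<Sum>n<N. f n x"])
       (use f sums in \<open>auto simp: sums_def\<close>)
  have int: "integrable M (f n)" for n
  proof (rule Bochner_Integration.integrable_bound[OF w f], rule AE_I2)
    fix x :: 'a
    have "norm (f n x) \<le> (\<Sum>k<Suc n. norm (f k x))" by (simp add: sum_nonneg)
    also have "\<dots> \<le> norm (w x)" using order_trans[OF bound[where N = "Suc n" and x = x] abs_ge_self] by simp
    finally show "norm (f n x) \<le> norm (w x)" .
  qed
  show "integrable M g"
    by (rule integrable_dominated_convergence[where w = w and s = "\<lambda>N x. \<Sum>n<N. f n x"])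
       (use f g w bound' sums in \<open>auto simp: sums_def\<close>)
  have "(\<lambda>N. integral\<^sup>L M (\<lambda>x. \<Sum>n<N. f n x)) \<longlonglongrightarrow> integral\<^sup>L M g"
    by (rule integral_dominated_convergence[where w = w])
       (use f g w bound' sums in \<open>auto simp: sums_def\<close>)
  thus "(\<lambda>n. integral\<^sup>L M (f n)) sums integral\<^sup>L M g"
    by (simp add: sums_def int)
qed

lemma integrable_exp_minus_abs:
  fixes c :: real
  assumes "c > 0"
  shows "integrable lborel (\<lambda>x. exp (- c * \<bar>x\<bar>))"
proof -
  have "has_bochner_integral lborel (\<lambda>x::real. indicator {0..} x *\<^sub>R (exp (- x))) (fact 0)"
    using has_bochner_integral_I0i_power_exp_m'[of 0] by (simp add: mult.commute)
  hence "has_bochner_integral lborel (\<lambda>x::real. indicator {0..} x *\<^sub>R (exp (- \<bar>x\<bar>))) (fact 0)"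
    by (rule has_bochner_integral_cong[THEN iffD1, rotated 3]) (auto simp: indicator_def)
  from has_bochner_integral_even_function[OF this]
  have "integrable lborel (\<lambda>x::real. exp (- \<bar>x\<bar>))"
    by (auto simp: has_bochner_integral_iff)
  from lborel_integrable_real_affine[OF this, of c 0] assms
  show ?thesis by (simp add: abs_mult)
qed

lemma exp_series_partial_le:
  fixes y :: real
  assumes "y \<ge> 0"
  shows "(\<Sum>n<N. y ^ n / fact n) \<le> exp y"
proof -
  have "(\<lambda>n. y ^ n / fact n) sums exp y"
    using exp_converges[of y] by (simp add: scaleR_conv_of_real field_simps)
  thus ?thesis using assms
    using sum_le_suminf[of "\<lambda>n. y ^ n / fact n" "{..<N}"] by (simp add: sums_iff)
qed

text \<open>Around s0 the exponential is expanded in powers of w - s0 and integrated term by term.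
  The norms sum to at most |F x| exp ((|Re s0| + |w - s0|) |x|), which is integrable for |w - s0| <
  C - |Re s0|; this is the radius \<open>?r s0\<close>.\<close>

lemma laplace_holomorphic:
  fixes F :: "real \<Rightarrow> complex" and C :: real
  assumes [measurable]: "F \<in> borel_measurable borel"
    and int: "\<And>c. c < C \<Longrightarrow> integrable lborel (\<lambda>x. norm (F x) * exp (c * \<bar>x\<bar>))"
  shows "(\<lambda>s. LINT x|lborel. F x * exp (s * of_real x)) holomorphic_on {s. \<bar>Re s\<bar> < C}"
proof -
  let ?L = "\<lambda>s. LINT x|lborel. F x * exp (s * of_real x)"
  let ?r = "\<lambda>s. C - \<bar>Re s\<bar>"
  have "?L holomorphic_on ball s0 (?r s0)" for s0
  proof (rule power_series_holomorphic)
    fix w assume "w \<in> ball s0 (?r s0)"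
    hence w: "\<bar>Re s0\<bar> + norm (w - s0) < C" by (simp add: dist_norm norm_minus_commute)
    define f where "f n x = F x * exp (s0 * of_real x) * (of_real x ^ n / fact n) * (w - s0) ^ n" for n and x :: real
    have "(\<lambda>n. integral\<^sup>L lborel (f n)) sums ?L w"
    proof (rule integral_sums_dominated[OF _ int[OF w]])
      show "(\<Sum>n<N. norm (f n x)) \<le> norm (F x) * exp ((\<bar>Re s0\<bar> + norm (w - s0)) * \<bar>x\<bar>)" for N x
      proof -
        have "(\<Sum>n<N. norm (f n x)) = norm (F x) * (exp (Re s0 * x) * (\<Sum>n<N. (\<bar>x\<bar> * norm (w - s0)) ^ n / fact n))"
          by (simp add: f_def norm_mult norm_divide norm_power sum_distrib_left power_mult_distrib mult_ac)
        also have "\<dots> \<le> norm (F x) * (exp (\<bar>Re s0\<bar> * \<bar>x\<bar>) * exp (\<bar>x\<bar> * norm (w - s0)))"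
          by (intro mult_left_mono mult_mono exp_series_partial_le)
             (auto simp: abs_mult[symmetric] intro!: sum_nonneg)
        finally show ?thesis by (simp add: algebra_simps flip: exp_add)
      qed
      show "(\<lambda>n. f n x) sums (F x * exp (w * of_real x))" for x
      proof -
        have "(\<lambda>n. F x * exp (s0 * of_real x) * (((w - s0) * of_real x) ^ n /\<^sub>R fact n))
            sums (F x * exp (s0 * of_real x) * exp ((w - s0) * of_real x))"
          by (intro sums_mult exp_converges)
        moreover have "f n x = F x * exp (s0 * of_real x) * (((w - s0) * of_real x) ^ n /\<^sub>R fact n)" for n
          by (simp add: f_def scaleR_conv_of_real divide_inverse power_mult_distrib mult_ac)
        moreover have "F x * exp (s0 * of_real x) * exp ((w - s0) * of_real x) = F x * exp (w * of_real x)"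
          by (simp add: mult.assoc algebra_simps flip: exp_add)
        ultimately show ?thesis by simp
      qed
    qed (auto simp: f_def[abs_def])
    thus "(\<lambda>n. (LINT x|lborel. F x * exp (s0 * of_real x) * (of_real x ^ n / fact n)) * (w - s0) ^ n) sums ?L w"
      by (simp add: f_def[abs_def])
  qed
  hence "?L holomorphic_on (\<Union>s0\<in>{s. \<bar>Re s\<bar> < C}. ball s0 (?r s0))"
    by (intro holomorphic_on_UN_open) auto
  thus ?thesis
    by (rule holomorphic_on_subset) (force intro!: centre_in_ball[THEN iffD2])
qed

section \<open>Vertical-line integrals of products of two Gamma functions\<close>

lemma Gamma_vertical_continuous [continuous_intros]:
  fixes a :: real
  assumes "a > 0"
  shows "continuous_on A (\<lambda>x. Gamma (of_real a + \<i> * of_real x))"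
    and "continuous_on A (\<lambda>x. Gamma (of_real a - \<i> * of_real x))"
  by (use assms in \<open>intro continuous_at_imp_continuous_on ballI isCont_Gamma continuous_intros;
        auto elim!: nonpos_Ints_cases simp: complex_eq_iff\<close>)+

lemma Gamma_vertical_measurable [measurable (raw)]:
  fixes a :: real
  assumes "a > 0"
  shows "(\<lambda>x. Gamma (of_real a + \<i> * of_real x)) \<in> borel_measurable borel"
    and "(\<lambda>x. Gamma (of_real a - \<i> * of_real x)) \<in> borel_measurable borel"
  by (intro borel_measurable_continuous_onI Gamma_vertical_continuous assms)+

lemma integrable_Gamma_vertical:
  assumes "a > 0"
  shows "integrable lborel (\<lambda>x. Gamma (of_real a + \<i> * of_real x))"
proof -
  have "(1::real) < pi / 2" using pi_gt3 by simp
  from norm_Gamma_exp_decay[OF assms this] obtain C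
    where C: "\<And>x. cmod (Gamma (of_real a + \<i> * of_real x)) \<le> C * exp (- 1 * \<bar>x\<bar>)" by blast
  show ?thesis
  proof (rule Bochner_Integration.integrable_bound)
    show "integrable lborel (\<lambda>x. C * exp (- 1 * \<bar>x\<bar>))"
      using integrable_exp_minus_abs[of 1] by simp
    show "AE x in lborel. norm (Gamma (of_real a + \<i> * of_real x)) \<le> norm (C * exp (- 1 * \<bar>x\<bar>))"
      using C by (intro AE_I2) (metis abs_ge_self order_trans real_norm_def)
  qed (use Gamma_vertical_measurable[OF assms] in auto)
qed

text \<open>Writing Gamma(b - ix) as a Fourier integral and inverting the transform Gamma(a + ix)
  leaves 2 pi times the integral of \<open>h a (v + s) * h b s\<close> over s. There exp (v + s) +
  exp s = (1 + exp v) exp s, so a shift by ln (1 + exp v) makes it Euler's integral for Gamma(a +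
  b).\<close>

lemma Gamma_mult_fourier:
  fixes a b v :: real
  assumes a: "a > 0" and b: "b > 0"
  shows "(LINT x|lborel. Gamma (of_real a + \<i> * of_real x) * Gamma (of_real b - \<i> * of_real x) * iexp (- (v * x)))
    = of_real (2 * pi * Gamma (a + b) * exp (a * v) / (1 + exp v) powr (a + b))"
proof -
  define h where "h a u = complex_of_real (exp (a * u - exp u))" for a u :: real
  have hF: "(LINT u|lborel. h a u * iexp (u * x)) = Gamma (of_real a + \<i> * of_real x)"
    and hint: "integrable lborel (h a)" if "a > 0" for a x
    using Gamma_fourier[OF that, of x] Gamma_fourier[OF that, of 0]
    by (simp_all add: has_bochner_integral_iff h_def[abs_def])
  \<comment> \<open>The exponent a u - exp u is largest at u = ln a.\<close>
  have hb: "norm (h a u) \<le> exp (a * ln a - a)" for u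
  proof -
    have "u - ln a + 1 \<le> exp (u - ln a)" using exp_ge_add_one_self[of "u - ln a"] by linarith
    also have "\<dots> = exp u / a" using a by (simp add: exp_diff)
    finally have "a * (u - ln a + 1) \<le> exp u" using a by (simp add: field_simps)
    thus ?thesis by (simp add: h_def algebra_simps)
  qed
  have inv: "(LINT x|lborel. Gamma (of_real a + \<i> * of_real x) * iexp (- (s * x))) = 2 * of_real pi * h a s" for s
  proof -
    have "(LINT x|lborel. (LINT u|lborel. h a u * iexp (u * x)) * iexp (- (s * x))) = 2 * of_real pi * h a s"
    proof (rule fourier_inversion[OF hint[OF a] _ hb])
      show "continuous_on UNIV (h a)" unfolding h_def[abs_def] by (intro continuous_intros)
      show "integrable lborel (\<lambda>x. LINT u|lborel. h a u * iexp (u * x))"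
        unfolding hF[OF a] by (rule integrable_Gamma_vertical[OF a])
    qed
    thus ?thesis unfolding hF[OF a] .
  qed
  have "(LINT x|lborel. Gamma (of_real a + \<i> * of_real x) * Gamma (of_real b - \<i> * of_real x) * iexp (- (v * x)))
      = (LINT x|lborel. LINT s|lborel. Gamma (of_real a + \<i> * of_real x) * iexp (- ((v + s) * x)) * h b s)"
  proof (intro Bochner_Integration.integral_cong refl)
    fix x :: real
    have "Gamma (of_real b - \<i> * of_real x) = (LINT s|lborel. h b s * iexp (- (s * x)))"
      using hF[OF b, of "- x"] by simp
    hence "Gamma (of_real a + \<i> * of_real x) * Gamma (of_real b - \<i> * of_real x) * iexp (- (v * x))
      = (Gamma (of_real a + \<i> * of_real x) * iexp (- (v * x))) * (LINT s|lborel. h b s * iexp (- (s * x)))"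
      by simp
    also have "\<dots> = (LINT s|lborel. (Gamma (of_real a + \<i> * of_real x) * iexp (- (v * x))) * (h b s * iexp (- (s * x))))"
      by (rule integral_mult_right_zero[symmetric])
    also have "\<dots> = (LINT s|lborel. Gamma (of_real a + \<i> * of_real x) * iexp (- ((v + s) * x)) * h b s)"
    proof (intro Bochner_Integration.integral_cong refl)
      fix s :: real
      have "iexp (- ((v + s) * x)) = iexp (- (v * x)) * iexp (- (s * x))"
        by (simp add: algebra_simps flip: exp_add)
      thus "(Gamma (of_real a + \<i> * of_real x) * iexp (- (v * x))) * (h b s * iexp (- (s * x)))
        = Gamma (of_real a + \<i> * of_real x) * iexp (- ((v + s) * x)) * h b s"
        by (simp only: mult_ac)
    qed
    finally show "Gamma (of_real a + \<i> * of_real x) * Gamma (of_real b - \<i> * of_real x) * iexp (- (v * x))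
      = (LINT s|lborel. Gamma (of_real a + \<i> * of_real x) * iexp (- ((v + s) * x)) * h b s)" .
  qed
  also have "\<dots> = (LINT s|lborel. LINT x|lborel. Gamma (of_real a + \<i> * of_real x) * iexp (- ((v + s) * x)) * h b s)"
  proof (rule lborel_pair.Fubini_integral,
         rule integrable_product_dominated[OF hint[OF b] integrable_Gamma_vertical[OF a]])
    note [measurable] = Gamma_vertical_measurable[OF a]
    show "(\<lambda>(s, x). Gamma (of_real a + \<i> * of_real x) * iexp (- ((v + s) * x)) * h b s) \<in> borel_measurable (lborel \<Otimes>\<^sub>M lborel)"
      unfolding h_def by measurable
  qed (simp add: norm_mult del: of_real_mult of_real_add of_real_minus)
  also have "\<dots> = (LINT s|lborel. 2 * of_real pi * h a (v + s) * h b s)"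
    by (simp only: integral_mult_left_zero inv)
  also have "\<dots> = (LINT s|lborel. 2 * of_real pi * h a (v + (- ln (1 + exp v) + 1 * s)) * h b (- ln (1 + exp v) + 1 * s))"
    by (subst lborel_integral_real_affine[where c = 1 and t = "- ln (1 + exp v)"]) auto
  also have "\<dots> = (LINT s|lborel. of_real (2 * pi * exp (a * v) / (1 + exp v) powr (a + b)) * h (a + b) s)"
  proof (intro Bochner_Integration.integral_cong refl)
    fix s :: real
    let ?l = "ln (1 + exp v)"
    have p: "1 + exp v > 0" by (intro add_pos_pos) auto
    have "exp (v + (s - ?l)) + exp (s - ?l) = (1 + exp v) * exp (s - ?l)"
      by (simp only: exp_add distrib_right mult_1_left add.commute)
    also have "\<dots> = exp s"
      using p by (simp add: exp_diff)
    finally have e: "exp s = exp (v + (s - ?l)) + exp (s - ?l)" ..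
    have "exp (a * (v + (s - ?l)) - exp (v + (s - ?l))) * exp (b * (s - ?l) - exp (s - ?l))
       = exp (a * v - (a + b) * ?l + ((a + b) * s - exp s))"
      unfolding e mult_exp_exp by (simp add: algebra_simps)
    also have "\<dots> = exp (a * v) / (1 + exp v) powr (a + b) * exp ((a + b) * s - exp s)"
      using p by (simp only: exp_add exp_diff[of "a * v"]) (simp add: powr_def)
    finally have "2 * pi * (exp (a * (v + (s - ?l)) - exp (v + (s - ?l))) * exp (b * (s - ?l) - exp (s - ?l)))
       = 2 * pi * exp (a * v) / (1 + exp v) powr (a + b) * exp ((a + b) * s - exp s)"
      by simp
    hence "complex_of_real (2 * pi * (exp (a * (v + (s - ?l)) - exp (v + (s - ?l))) * exp (b * (s - ?l) - exp (s - ?l))))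
       = of_real (2 * pi * exp (a * v) / (1 + exp v) powr (a + b) * exp ((a + b) * s - exp s))"
      by (rule arg_cong)
    moreover have "- ?l + 1 * s = s - ?l" by simp
    ultimately show "2 * of_real pi * h a (v + (- ?l + 1 * s)) * h b (- ?l + 1 * s)
       = of_real (2 * pi * exp (a * v) / (1 + exp v) powr (a + b)) * h (a + b) s"
      unfolding h_def of_real_mult[of _ "exp ((a + b) * s - exp s)", symmetric]
      by (simp only: of_real_mult of_real_numeral mult.assoc)
  qed
  also have "\<dots> = of_real (2 * pi * exp (a * v) / (1 + exp v) powr (a + b)) * of_real (Gamma (a + b))"
    using hF[of "a + b" 0] a b by (simp add: Gamma_complex_of_real flip: of_real_add)
  finally show ?thesis by (simp add: mult_ac)
qed

lemma Gamma_mult_exp_integrable: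
  fixes a b c :: real
  assumes a: "a > 0" and b: "b > 0" and c: "c < pi"
  shows "integrable lborel (\<lambda>x. cmod (Gamma (of_real a + \<i> * of_real x) * Gamma (of_real b - \<i> * of_real x)) * exp (c * \<bar>x\<bar>))"
proof -
  note [measurable] = Gamma_vertical_measurable[OF a] Gamma_vertical_measurable[OF b]
  \<comment> \<open>Midway between c / 2 and pi / 2: each Gamma factor decays at rate d, and the
    joint rate 2 d exceeds c.\<close>
  define d where "d = (c + pi) / 4"
  have d: "d < pi / 2" "2 * d - c > 0" using c by (auto simp: d_def)
  obtain A where A: "\<And>x. cmod (Gamma (of_real a + \<i> * of_real x)) \<le> A * exp (- d * \<bar>x\<bar>)"
    using norm_Gamma_exp_decay[OF a d(1)] by blast
  obtain B where B: "\<And>x. cmod (Gamma (of_real b + \<i> * of_real x)) \<le> B * exp (- d * \<bar>x\<bar>)"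
    using norm_Gamma_exp_decay[OF b d(1)] by blast
  show ?thesis
  proof (rule Bochner_Integration.integrable_bound)
    show "integrable lborel (\<lambda>x. A * B * exp (- (2 * d - c) * \<bar>x\<bar>))"
      using integrable_exp_minus_abs[OF d(2)] by simp
    show "AE x in lborel. norm (cmod (Gamma (of_real a + \<i> * of_real x) * Gamma (of_real b - \<i> * of_real x)) * exp (c * \<bar>x\<bar>))
        \<le> norm (A * B * exp (- (2 * d - c) * \<bar>x\<bar>))"
    proof (rule AE_I2)
      fix x :: real
      have "cmod (Gamma (of_real a + \<i> * of_real x)) * cmod (Gamma (of_real b + \<i> * of_real (- x)))
          \<le> (A * exp (- d * \<bar>x\<bar>)) * (B * exp (- d * \<bar>x\<bar>))"
        using A[of x] B[of "- x"] order_trans[OF norm_ge_zero A[of x]] by (intro mult_mono) auto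
      hence "cmod (Gamma (of_real a + \<i> * of_real x)) * cmod (Gamma (of_real b + \<i> * of_real (- x))) * exp (c * \<bar>x\<bar>)
          \<le> (A * exp (- d * \<bar>x\<bar>)) * (B * exp (- d * \<bar>x\<bar>)) * exp (c * \<bar>x\<bar>)"
        by (rule mult_right_mono) simp
      also have "\<dots> = A * B * exp (- (2 * d - c) * \<bar>x\<bar>)"
      proof -
        have "exp (- (2 * d - c) * \<bar>x\<bar>) = exp (- d * \<bar>x\<bar>) * exp (- d * \<bar>x\<bar>) * exp (c * \<bar>x\<bar>)"
          by (simp add: algebra_simps flip: exp_add)
        thus ?thesis by (simp only: mult_ac)
      qed
      also have "\<dots> \<le> norm (A * B * exp (- (2 * d - c) * \<bar>x\<bar>))" by simp
      finally show "norm (cmod (Gamma (of_real a + \<i> * of_real x) * Gamma (of_real b - \<i> * of_real x)) * exp (c * \<bar>x\<bar>))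
        \<le> norm (A * B * exp (- (2 * d - c) * \<bar>x\<bar>))"
        by (simp add: norm_mult)
    qed
  qed measurable
qed

text \<open>Keeps 2 cos (s / 2) off the branch cut of \<open>Ln\<close> on the strip of the next
  lemma. The reason is Re (cos (x + iy)) = cos x cosh y.\<close>

lemma Re_cos_half_pos:
  assumes "\<bar>Re s\<bar> < pi"
  shows "Re (cos (s / 2)) > 0"
proof -
  have "cos (Re s / 2) > 0" using assms by (intro cos_gt_zero_pi) auto
  moreover have "exp (Im s / 2) + exp (- (Im s / 2)) > 0" by (intro add_pos_pos) auto
  ultimately show ?thesis by (simp add: Re_cos)
qed

lemma Gamma_mult_exp_integral:
  fixes a b \<psi> :: real
  assumes a: "a > 0" and b: "b > 0" and \<psi>: "\<psi> \<in> {0<..<pi}"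
  shows "has_bochner_integral lborel
     (\<lambda>x. Gamma (of_real a + \<i> * of_real x) * Gamma (of_real b - \<i> * of_real x) * of_real (exp ((2 * \<psi> - pi) * x)))
     (of_real (2 * pi * Gamma (a + b) / (2 * sin \<psi>) powr (a + b)) * iexp ((a - b) * (\<psi> - pi / 2)))"
proof -
  note [measurable] = Gamma_vertical_measurable[OF a] Gamma_vertical_measurable[OF b]
  define F where "F x = Gamma (of_real a + \<i> * of_real x) * Gamma (of_real b - \<i> * of_real x)" for x :: real
  have [measurable]: "F \<in> borel_measurable borel" unfolding F_def by measurable
  have Fint: "integrable lborel (\<lambda>x. norm (F x) * exp (c * \<bar>x\<bar>))" if "c < pi" for c
    unfolding F_def using Gamma_mult_exp_integrable[OF a b that] .
  define L where "L s = (LINT x|lborel. F x * exp (s * of_real x))" for s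
  \<comment> \<open>Continuation of the known value on the imaginary axis: exp (a v) / (1 + exp
    v)^(a + b) = exp ((a - b) v / 2) / (2 cosh (v / 2))^(a + b), and v = is gives cosh (v / 2) = cos
    (s / 2).\<close>
  define R where "R s = of_real (2 * pi * Gamma (a + b)) * exp (\<i> * of_real (a - b) * s / 2)
      / exp (of_real (a + b) * Ln (2 * cos (s / 2)))" for s
  define S where "S = {s. \<bar>Re s\<bar> < pi}"
  have S: "S = {s. Re s > - pi} \<inter> {s. Re s < pi}" by (auto simp: S_def)
  have "open S" unfolding S by (intro open_Int open_halfspace_Re_lt open_halfspace_Re_gt)
  have "connected S" unfolding S
    by (intro convex_connected convex_Int convex_halfspace_Re_lt convex_halfspace_Re_gt)
  have pos: "2 * cos (s / 2) \<notin> \<real>\<^sub>\<le>\<^sub>0" if "s \<in> S" for s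
    using Re_cos_half_pos[of s] that by (auto simp: S_def complex_nonpos_Reals_iff)
  have "L holomorphic_on S"
    unfolding L_def S_def by (rule laplace_holomorphic) (use Fint in auto)
  moreover have "R holomorphic_on S"
    unfolding R_def using pos by (intro holomorphic_intros) auto
  ultimately have hol: "(\<lambda>s. L s - R s) holomorphic_on S" by (rule holomorphic_on_diff)
  have line: "L (- (\<i> * of_real v)) = R (- (\<i> * of_real v))" for v :: real
  proof -
    have "2 * cos (- (\<i> * of_real v) / 2) = of_real (exp (v / 2) + exp (- (v / 2)))"
      by (simp add: cos_exp_eq flip: exp_of_real)
    also have "exp (v / 2) + exp (- (v / 2)) = exp (- (v / 2)) * (1 + exp v)"
      by (simp add: algebra_simps flip: exp_add)
    finally have "Ln (2 * cos (- (\<i> * of_real v) / 2)) = Ln (of_real (exp (- (v / 2)) * (1 + exp v)))"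
      by simp
    also have "Ln (of_real (exp (- (v / 2)) * (1 + exp v))) = of_real (ln (exp (- (v / 2)) * (1 + exp v)))"
      by (intro Ln_of_real mult_pos_pos add_pos_pos) auto
    also have "ln (exp (- (v / 2)) * (1 + exp v)) = ln (1 + exp v) - v / 2"
      using add_pos_pos[of 1 "exp v"] by (simp add: ln_mult)
    finally have "Ln (2 * cos (- (\<i> * of_real v) / 2)) = of_real (ln (1 + exp v) - v / 2)" .
    moreover have "\<i> * of_real (a - b) * - (\<i> * of_real v) / 2 = of_real ((a - b) * v / 2)"
      by (simp add: complex_eq_iff)
    ultimately have "R (- (\<i> * of_real v)) = of_real (2 * pi * Gamma (a + b) * (exp ((a - b) * v / 2)
        / exp ((a + b) * (ln (1 + exp v) - v / 2))))"
      by (simp only: R_def exp_of_real of_real_mult[symmetric] of_real_divide[symmetric] times_divide_eq_right)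
    also have "exp ((a - b) * v / 2) / exp ((a + b) * (ln (1 + exp v) - v / 2)) = exp (a * v) / (1 + exp v) powr (a + b)"
    proof -
      have "1 + exp v > 0" by (intro add_pos_pos) auto
      thus ?thesis
        by (simp add: powr_def flip: exp_diff) (simp add: field_simps)
    qed
    finally show ?thesis
      using Gamma_mult_fourier[OF a b, of v] by (simp add: L_def F_def mult_ac times_divide_eq_right[symmetric] del: times_divide_eq_right)
  qed
  \<comment> \<open>Identity theorem: \<open>L\<close> and \<open>R\<close> agree on the imaginary
    axis, which accumulates at 0 inside the connected strip.\<close>
  have LR: "L s = R s" if "s \<in> S" for s
  proof -
    have "0 islimpt range (\<lambda>v::real. - (\<i> * of_real v))"
      unfolding islimpt_approachable
    proof (intro allI impI)
      fix e :: real assume "e > 0"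
      thus "\<exists>x'\<in>range (\<lambda>v::real. - (\<i> * of_real v)). x' \<noteq> 0 \<and> dist x' 0 < e"
        by (intro bexI[OF _ rangeI[of _ "e / 2"]]) (auto simp: norm_mult)
    qed
    hence "L s - R s = 0"
      by (rule analytic_continuation[OF hol \<open>open S\<close> \<open>connected S\<close> _ _ _ _ that, rotated 2])
         (auto simp: S_def line)
    thus ?thesis by simp
  qed
  \<comment> \<open>At this real point cos (s / 2) = cos (\<psi> - pi / 2) = sin \<psi> > 0, so the
    logarithm is real and the complex power becomes \<open>powr\<close>.\<close>
  define s where "s = complex_of_real (2 * \<psi> - pi)"
  have s: "s \<in> S" using \<psi> by (auto simp: S_def s_def)
  have "integrable lborel (\<lambda>x. F x * of_real (exp ((2 * \<psi> - pi) * x)))"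
  proof (rule Bochner_Integration.integrable_bound[OF Fint[of "\<bar>2 * \<psi> - pi\<bar>"]])
    show "\<bar>2 * \<psi> - pi\<bar> < pi" using \<psi> by auto
    show "AE x in lborel. norm (F x * of_real (exp ((2 * \<psi> - pi) * x))) \<le> norm (norm (F x) * exp (\<bar>2 * \<psi> - pi\<bar> * \<bar>x\<bar>))"
      by (intro AE_I2) (auto simp: norm_mult abs_mult[symmetric] intro!: mult_left_mono)
  qed measurable
  moreover have "(LINT x|lborel. F x * of_real (exp ((2 * \<psi> - pi) * x))) = L s"
    by (simp add: L_def s_def flip: exp_of_real)
  moreover have "R s = of_real (2 * pi * Gamma (a + b) / (2 * sin \<psi>) powr (a + b)) * iexp ((a - b) * (\<psi> - pi / 2))"
  proof -
    have sin: "sin \<psi> > 0" using \<psi> by (intro sin_gt_zero) auto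
    have "s / 2 = of_real (\<psi> - pi / 2)" by (simp add: s_def field_simps)
    hence "2 * cos (s / 2) = of_real (2 * sin \<psi>)"
      by (simp only: cos_of_real) (simp add: cos_diff)
    hence "exp (of_real (a + b) * Ln (2 * cos (s / 2))) = of_real ((2 * sin \<psi>) powr (a + b))"
      using sin by (simp only: Ln_of_real) (simp add: Ln_of_real powr_def flip: exp_of_real)
    moreover have "\<i> * of_real (a - b) * s / 2 = \<i> * of_real ((a - b) * (\<psi> - pi / 2))"
      by (simp add: s_def field_simps)
    ultimately show ?thesis by (simp only: R_def of_real_divide of_real_mult mult_ac times_divide_eq_right times_divide_eq_left)
  qed
  ultimately show ?thesis
    using LR[OF s] by (simp add: has_bochner_integral_iff F_def)
qed

section \<open>Kummer series\<close>

lemma pochhammer_neg_of_nat: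
  assumes "i \<le> m"
  shows "pochhammer (- of_nat m) i = (-1) ^ i * fact m / (fact (m - i) :: 'a :: field_char_0)"
proof -
  have "(-1) ^ i * pochhammer (- of_nat m) i / fact i = (of_nat (m choose i) :: 'a)"
    by (simp add: binomial_gbinomial gbinomial_pochhammer)
  also have "\<dots> = fact m / (fact i * fact (m - i))"
    using assms by (rule binomial_fact)
  finally have *: "(-1) ^ i * pochhammer (- of_nat m) i = fact m / (fact (m - i) :: 'a)"
    by (simp add: field_simps)
  have "pochhammer (- of_nat m) i = (-1) ^ i * ((-1) ^ i * pochhammer (- of_nat m) i :: 'a)"
    by (simp flip: power_mult_distrib mult.assoc)
  thus ?thesis unfolding * by simp
qed

lemma pochhammer_of_real_nonzero:
  assumes "c > 0"
  shows "pochhammer (of_real c :: 'a :: real_normed_field) n \<noteq> 0"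
  using pochhammer_pos[OF assms, of n] by (simp add: pochhammer_of_real)

text \<open>Successive terms have ratio y / (c + n), at most 1/2 once n \<ge> 2 y, so the quotients
  are even summable.\<close>

lemma power_over_pochhammer_bounded:
  fixes c y :: real
  assumes c: "c > 0" and y: "y \<ge> 0"
  obtains K where "K \<ge> 0" "\<And>n. y ^ n / pochhammer c n \<le> K"
proof -
  obtain N where N: "real N \<ge> 2 * y" using real_arch_simple by blast
  have "summable (\<lambda>n. y ^ n / pochhammer c n)"
  proof (rule summable_ratio_test[of "1/2" N])
    fix n assume n: "n \<ge> N"
    hence "2 * y \<le> c + real n" using N c by linarith
    hence "y / (c + real n) \<le> 1 / 2" using c by (simp add: field_simps)
    hence "y / (c + real n) * (y ^ n / pochhammer c n) \<le> 1 / 2 * (y ^ n / pochhammer c n)"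
      using c y by (intro mult_right_mono) (auto intro!: divide_nonneg_nonneg pochhammer_nonneg)
    thus "norm (y ^ Suc n / pochhammer c (Suc n)) \<le> 1 / 2 * norm (y ^ n / pochhammer c n)"
      using c y pochhammer_nonneg[OF c, of n] by (simp add: pochhammer_Suc mult_ac)
  qed simp
  hence "Bseq (\<lambda>n. y ^ n / pochhammer c n)"
    by (intro convergent_imp_Bseq summable_imp_convergent)
  then obtain K where "K > 0" "\<And>n. norm (y ^ n / pochhammer c n) \<le> K"
    by (auto elim: BseqE)
  thus ?thesis
    by (intro that[of K]) (auto intro: order_trans[OF abs_ge_self])
qed

text \<open>The terms are nonnegative and belong to the binomial series of (1 - s)^(-a), whose full
  sum bounds every partial sum.\<close>

lemma pochhammer_power_partial_le:
  fixes a s :: real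
  assumes "a \<ge> 0" "0 \<le> s" "s < 1"
  shows "(\<Sum>n<N. pochhammer a n / fact n * s ^ n) \<le> (1 - s) powr (- a)"
proof -
  have "(\<lambda>n. (- a gchoose n) * (- s) ^ n) sums (1 + - s) powr (- a)"
    using assms by (intro gen_binomial_real) auto
  moreover have "(- a gchoose n) * (- s) ^ n = pochhammer a n / fact n * s ^ n" for n
    by (simp add: gbinomial_pochhammer power_minus[of s])
  ultimately have "(\<lambda>n. pochhammer a n / fact n * s ^ n) sums (1 - s) powr (- a)" by simp
  moreover have "pochhammer a n \<ge> 0" for n
    using assms by (auto simp: pochhammer_prod intro!: prod_nonneg)
  ultimately show ?thesis
    using sum_le_suminf[of "\<lambda>n. pochhammer a n / fact n * s ^ n" "{..<N}"] assms
    by (simp add: sums_iff)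
qed

lemma norm_pochhammer_le:
  fixes a :: "'a :: {real_normed_field}"
  shows "norm (pochhammer a n) \<le> pochhammer (norm a) n"
proof -
  have "norm (a + of_nat i) \<le> norm a + real i" for i
    by (rule order_trans[OF norm_triangle_ineq]) simp
  thus ?thesis
    unfolding pochhammer_prod prod_norm[symmetric] by (intro prod_mono) auto
qed

text \<open>Since \<open>z\<^bsup>n\<^esup> / (c)\<^sub>n\<close> is dominated by \<open>s\<^bsup>n\<^esup>\<close> for every \<open>s > 0\<close>, the binomial series
  \<open>(1 - s)\<^bsup>-|a|\<^esup>\<close> is a majorant; \<open>s\<close> is chosen so that it equals \<open>exp (\<epsilon> |a|)\<close>.\<close>

lemma kummer_series_bound:
  fixes c \<epsilon> :: real and z :: complex
  assumes c: "c > 0" and \<epsilon>: "\<epsilon> > 0"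
  obtains K where "K \<ge> 0"
    "\<And>a N. (\<Sum>n<N. norm (pochhammer a n / pochhammer (of_real c) n * (z ^ n / fact n))) \<le> K * exp (\<epsilon> * norm a)"
proof -
  define s where "s = 1 - exp (- \<epsilon>)"
  have s: "0 < s" "s < 1" using \<epsilon> by (auto simp: s_def)
  \<comment> \<open>This K does not depend on a: all dependence on a is left to the binomial
    series.\<close>
  obtain K where K: "K \<ge> 0" "\<And>n. (norm z / s) ^ n / pochhammer c n \<le> K"
    using power_over_pochhammer_bounded[OF c, of "norm z / s"] s by auto
  have "(\<Sum>n<N. norm (pochhammer a n / pochhammer (of_real c) n * (z ^ n / fact n))) \<le> K * exp (\<epsilon> * norm a)" for a N
  proof -
    have "norm (pochhammer a n / pochhammer (of_real c) n * (z ^ n / fact n))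
        \<le> K * (pochhammer (norm a) n / fact n * s ^ n)" for n
    proof -
      have "norm (pochhammer a n / pochhammer (of_real c) n * (z ^ n / fact n))
          = ((norm z / s) ^ n / pochhammer c n) * (norm (pochhammer a n) / fact n * s ^ n)"
        using s pochhammer_nonneg[OF c, of n]
        by (simp add: norm_mult norm_divide norm_power pochhammer_of_real power_divide)
      also have "\<dots> \<le> K * (pochhammer (norm a) n / fact n * s ^ n)"
        using s K by (intro mult_mono mult_right_mono divide_right_mono norm_pochhammer_le) auto
      finally show ?thesis .
    qed
    hence "(\<Sum>n<N. norm (pochhammer a n / pochhammer (of_real c) n * (z ^ n / fact n)))
        \<le> K * (\<Sum>n<N. pochhammer (norm a) n / fact n * s ^ n)"
      unfolding sum_distrib_left by (intro sum_mono)
    also have "\<dots> \<le> K * (1 - s) powr (- norm a)"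
      using K s by (intro mult_left_mono pochhammer_power_partial_le) auto
    also have "(1 - s) powr (- norm a) = exp (\<epsilon> * norm a)"
      by (simp add: s_def powr_def mult_ac)
    finally show ?thesis .
  qed
  with K(1) show ?thesis using that by blast
qed

lemma summable_norm_kummer_series:
  assumes "c > 0"
  shows "summable (\<lambda>n. norm (pochhammer a n / pochhammer (complex_of_real c) n * (z ^ n / fact n)))"
proof -
  obtain K where K: "\<And>a N. (\<Sum>n<N. norm (pochhammer a n / pochhammer (complex_of_real c) n * (z ^ n / fact n))) \<le> K * exp (1 * norm a)"
    using kummer_series_bound[OF assms, of 1 z] zero_less_one by blast
  show ?thesis
    by (rule summableI_nonneg_bounded[OF _ K]) auto
qed

lemma hypergeom_1F1_sums:
  assumes "c > 0"
  shows "(\<lambda>n. pochhammer a n / pochhammer (complex_of_real c) n * (z ^ n / fact n)) sums hypergeom [a] [of_real c] z"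
  using summable_sums[OF summable_norm_cancel[OF summable_norm_kummer_series[OF assms]], of a z]
  by (simp add: hypergeom_def)

text \<open>When the series on the right is multiplied by that of exp z, the coefficient of z^m is a
  terminating sum. Chu-Vandermonde evaluates it, with c - (c - a) = a as the resulting
  parameter.\<close>

lemma kummer_transformation:
  assumes c: "c > 0"
  shows "hypergeom [a] [of_real c] z = exp z * hypergeom [of_real c - a] [of_real c] (- z)"
proof -
  let ?c = "complex_of_real c"
  let ?f = "\<lambda>n. pochhammer (?c - a) n / pochhammer ?c n * ((- z) ^ n / fact n)"
  have e: "(\<lambda>n. z ^ n / fact n) sums exp z"
    using exp_converges[of z] by (simp add: scaleR_conv_of_real field_simps)
  have "summable (\<lambda>n. norm (z ^ n / fact n))"
    using summable_norm_exp[of z] by (simp add: norm_divide norm_power field_simps)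
  from Cauchy_product_sums[OF summable_norm_kummer_series[OF c] this]
  have "(\<lambda>m. \<Sum>i\<le>m. ?f i * (z ^ (m - i) / fact (m - i))) sums (hypergeom [?c - a] [?c] (- z) * exp z)"
    using e hypergeom_1F1_sums[OF c] by (simp add: sums_iff)
  moreover have "(\<Sum>i\<le>m. ?f i * (z ^ (m - i) / fact (m - i))) = pochhammer a m / pochhammer ?c m * (z ^ m / fact m)" for m
  proof -
    \<comment> \<open>The factor 1 / (m - i)! is (-1)^i (-m)_i / m!, and its sign cancels that of
      (-z)^i.\<close>
    have "(\<Sum>i\<le>m. ?f i * (z ^ (m - i) / fact (m - i)))
        = (\<Sum>i\<le>m. z ^ m / fact m * (pochhammer (?c - a) i * pochhammer (- of_nat m) i / (of_nat (fact i) * pochhammer ?c i)))"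
    proof (intro sum.cong refl)
      fix i assume "i \<in> {..m}"
      hence i: "i \<le> m" by simp
      hence "z ^ m = z ^ i * z ^ (m - i)" by (simp flip: power_add)
      thus "?f i * (z ^ (m - i) / fact (m - i))
        = z ^ m / fact m * (pochhammer (?c - a) i * pochhammer (- of_nat m) i / (of_nat (fact i) * pochhammer ?c i))"
        by (simp add: pochhammer_neg_of_nat[OF i] power_minus[of z] mult_ac)
    qed
    also have "\<dots> = z ^ m / fact m * (pochhammer (?c - (?c - a)) m / pochhammer ?c m)"
      unfolding sum_distrib_left[symmetric] atMost_atLeast0
      by (subst Vandermonde_pochhammer) (use c in \<open>auto simp: complex_eq_iff\<close>)
    finally show ?thesis by (simp add: mult_ac)
  qed
  ultimately have "(\<lambda>m. pochhammer a m / pochhammer ?c m * (z ^ m / fact m)) sums (hypergeom [?c - a] [?c] (- z) * exp z)"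
    by simp
  with hypergeom_1F1_sums[OF c, of a z] show ?thesis
    by (metis sums_unique2 mult.commute)
qed

text \<open>(-n)_k vanishes for n < k, and otherwise (-n)_k / n! = (-1)^k / (n - k)!; shifting the
  index by k leaves the exponential series.\<close>

lemma pochhammer_neg_exp_sums:
  fixes y :: complex
  shows "(\<lambda>n. pochhammer (- of_nat n) k * y ^ n / fact n) sums ((- y) ^ k * exp y)"
proof -
  let ?f = "\<lambda>n. pochhammer (- of_nat n) k * y ^ n / fact n"
  have "(\<lambda>n. (- y) ^ k * (y ^ n /\<^sub>R fact n)) sums ((- y) ^ k * exp y)"
    by (intro sums_mult exp_converges)
  moreover have "?f (n + k) = (- y) ^ k * (y ^ n /\<^sub>R fact n)" for n
    using pochhammer_neg_of_nat[of k "n + k", where ?'a = complex]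
    by (simp add: scaleR_conv_of_real power_add power_minus[of y] field_simps)
  ultimately have "(\<lambda>n. ?f (n + k)) sums ((- y) ^ k * exp y)" by simp
  moreover have "?f n = 0" if "n < k" for n
    using that by (simp add: pochhammer_of_nat_eq_0_iff)
  ultimately show ?thesis by (subst (asm) sums_zero_iff_shift) auto
qed

text \<open>The series terminates because (-k)_j = 0 for j > k.\<close>

lemma meixner_pollaczek_altdef:
  "meixner_pollaczek k l x \<psi> = pochhammer (2 * of_real l) k / fact k * exp (\<i> * of_nat k * of_real \<psi>) *
     (\<Sum>j\<le>k. pochhammer (- of_nat k) j * pochhammer (of_real l + \<i> * x) j / pochhammer (2 * of_real l) j *
        ((1 - exp (- 2 * \<i> * of_real \<psi>)) ^ j / fact j))"
  unfolding meixner_pollaczek_def hypergeom_def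
  by (subst suminf_finite[of "{..k}"]) (auto simp: pochhammer_of_nat_eq_0_iff)

section \<open>Integrals of Meixner-Pollaczek polynomials\<close>

lemma Gamma_pochhammer:
  fixes l x :: real
  assumes "l > 0"
  shows "Gamma (of_real l + \<i> * of_real x) * pochhammer (of_real l + \<i> * of_real x) n = Gamma (of_real (l + real n) + \<i> * of_real x)"
    and "Gamma (of_real l - \<i> * of_real x) * pochhammer (of_real l - \<i> * of_real x) n = Gamma (of_real (l + real n) - \<i> * of_real x)"
proof -
  have *: "Gamma (of_real l + \<i> * of_real x) * pochhammer (of_real l + \<i> * of_real x) n = Gamma (of_real (l + real n) + \<i> * of_real x)" for x
  proof -
    have "of_real l + \<i> * of_real x \<notin> \<int>\<^sub>\<le>\<^sub>0"
      using assms by (auto elim!: nonpos_Ints_cases simp: complex_eq_iff)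
    thus ?thesis
      by (simp add: pochhammer_Gamma Gamma_eq_zero_iff add_ac)
  qed
  show "Gamma (of_real l + \<i> * of_real x) * pochhammer (of_real l + \<i> * of_real x) n = Gamma (of_real (l + real n) + \<i> * of_real x)"
    by (rule *)
  show "Gamma (of_real l - \<i> * of_real x) * pochhammer (of_real l - \<i> * of_real x) n = Gamma (of_real (l + real n) - \<i> * of_real x)"
    using *[of "- x"] by simp
qed

text \<open>This is \<open>Gamma_mult_exp_integral\<close> with a = l + j and b = l + n. The value
  is arranged so that j and n are coupled only through (2l)_(j + n), the form suited to the
  summations over j and n.\<close>

lemma Gamma_mult_exp_moment:
  fixes l \<psi> :: real and j n :: nat
  assumes l: "l > 0" and \<psi>: "\<psi> \<in> {0<..<pi}"
  shows "has_bochner_integral lborel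
     (\<lambda>x. Gamma (of_real (l + real j) + \<i> * of_real x) * Gamma (of_real (l + real n) - \<i> * of_real x) * of_real (exp ((2 * \<psi> - pi) * x)))
     (of_real (2 * pi * Gamma (2 * l) / (2 * sin \<psi>) powr (2 * l)) * pochhammer (2 * of_real l) (j + n)
       * (1 / (1 - exp (- 2 * \<i> * of_real \<psi>))) ^ j * (1 / (1 - exp (2 * \<i> * of_real \<psi>))) ^ n)"
proof -
  have sin: "sin \<psi> > 0" using \<psi> by (intro sin_gt_zero) auto
  define E where "E = iexp \<psi>"
  have E0: "E \<noteq> 0" by (simp add: E_def)
  have S: "of_real (2 * sin \<psi>) = (E - 1 / E) / \<i>"
  proof -
    have "of_real (2 * sin \<psi>) = 2 * sin (complex_of_real \<psi>)" by (simp add: sin_of_real)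
    also have "\<dots> = (E - 1 / E) / \<i>"
      unfolding sin_exp_eq E_def exp_minus inverse_eq_divide by simp
    finally show ?thesis .
  qed
  have S0: "E - 1 / E \<noteq> 0" using S sin by auto
  have E2: "exp (2 * \<i> * of_real \<psi>) = E ^ 2" "exp (- 2 * \<i> * of_real \<psi>) = 1 / E ^ 2"
    by (simp_all add: E_def exp_minus inverse_eq_divide mult.assoc flip: exp_double)
  \<comment> \<open>Here 1 - exp (-2 i \<psi>) = 2 i sin \<psi> exp (-i \<psi>), and 1 / i = exp (-i
    pi / 2).\<close>
  have q: "1 / (1 - exp (- 2 * \<i> * of_real \<psi>)) = iexp (\<psi> - pi / 2) / of_real (2 * sin \<psi>)"
  proof -
    have "iexp (\<psi> - pi / 2) = E / \<i>"
      by (simp add: E_def algebra_simps exp_diff exp_of_real flip: of_real_divide)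
         (simp add: exp_eq_polar cis_conv_exp[symmetric])
    thus ?thesis unfolding E2 S using E0 S0 by (simp add: field_simps power2_eq_square)
  qed
  have r: "1 / (1 - exp (2 * \<i> * of_real \<psi>)) = iexp (- (\<psi> - pi / 2)) / of_real (2 * sin \<psi>)"
  proof -
    have "1 / (1 - exp (2 * \<i> * of_real \<psi>)) = cnj (1 / (1 - exp (- 2 * \<i> * of_real \<psi>)))"
      by (simp add: exp_cnj)
    also have "\<dots> = cnj (iexp (\<psi> - pi / 2)) / of_real (2 * sin \<psi>)"
      unfolding q by simp
    also have "cnj (iexp (\<psi> - pi / 2)) = iexp (- (\<psi> - pi / 2))"
      unfolding exp_cnj by (rule arg_cong[of _ _ exp]) (simp add: complex_eq_iff)
    finally show ?thesis .
  qed
  have Gp: "Gamma (2 * l) > 0" using l by (intro Gamma_real_pos) simp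
  have G: "Gamma (2 * l) * pochhammer (2 * l) (j + n) = Gamma (2 * l + real (j + n))"
  proof -
    have "2 * l \<notin> \<int>\<^sub>\<le>\<^sub>0" using l by (auto elim!: nonpos_Ints_cases)
    from pochhammer_Gamma[OF this] show ?thesis
      using Gp by (metis less_imp_neq nonzero_mult_div_cancel_left times_divide_eq_right)
  qed
  have "of_real (2 * pi * Gamma (l + real j + (l + real n)) / (2 * sin \<psi>) powr (l + real j + (l + real n)))
       * iexp ((l + real j - (l + real n)) * (\<psi> - pi / 2))
     = of_real (2 * pi * Gamma (2 * l) / (2 * sin \<psi>) powr (2 * l)) * pochhammer (2 * of_real l) (j + n)
       * (1 / (1 - exp (- 2 * \<i> * of_real \<psi>))) ^ j * (1 / (1 - exp (2 * \<i> * of_real \<psi>))) ^ n"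
  proof -
    have "l + real j + (l + real n) = 2 * l + real (j + n)" by simp
    moreover have "(2 * sin \<psi>) powr (2 * l + real (j + n)) = (2 * sin \<psi>) powr (2 * l) * (2 * sin \<psi>) ^ j * (2 * sin \<psi>) ^ n"
      using sin by (simp add: powr_add powr_realpow power_add)
    moreover have "iexp ((l + real j - (l + real n)) * (\<psi> - pi / 2)) = iexp (\<psi> - pi / 2) ^ j * iexp (- (\<psi> - pi / 2)) ^ n"
      unfolding exp_of_nat_mult[symmetric] exp_add[symmetric]
      by (rule arg_cong[of _ _ exp]) (simp add: complex_eq_iff field_simps)
    moreover have "pochhammer (2 * complex_of_real l) (j + n) = of_real (pochhammer (2 * l) (j + n))"
      by (simp flip: pochhammer_of_real)
    ultimately show ?thesis
      unfolding q r power_divide by (simp only: G[symmetric]) (simp add: mult_ac)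
  qed
  thus ?thesis
    using Gamma_mult_exp_integral[of "l + real j" "l + real n" \<psi>] l \<psi> by simp
qed

text \<open>The Kummer series is integrated term by term: (l - ix)_n raises Gamma(l - ix) to Gamma(l
  + n - ix), after which \<open>Gamma_mult_exp_moment\<close> gives each term.\<close>

lemma Gamma_mult_kummer_integral:
  fixes l \<psi> :: real and j :: nat and z :: complex
  assumes l: "l > 0" and \<psi>: "\<psi> \<in> {0<..<pi}"
  defines "g \<equiv> \<lambda>x. Gamma (of_real (l + real j) + \<i> * of_real x) * Gamma (of_real l - \<i> * of_real x) * of_real (exp ((2 * \<psi> - pi) * x))
      * hypergeom [of_real l - \<i> * of_real x] [2 * of_real l] z"
  shows "integrable lborel g"
    and "(\<lambda>n. of_real (2 * pi * Gamma (2 * l) / (2 * sin \<psi>) powr (2 * l)) * pochhammer (2 * of_real l) (j + n)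
       * (1 / (1 - exp (- 2 * \<i> * of_real \<psi>))) ^ j * (1 / (1 - exp (2 * \<i> * of_real \<psi>))) ^ n
       * (z ^ n / (pochhammer (2 * of_real l) n * fact n))) sums integral\<^sup>L lborel g"
proof -
  define W where "W x = Gamma (of_real (l + real j) + \<i> * of_real x) * Gamma (of_real l - \<i> * of_real x)" for x :: real
  define \<theta> where "\<theta> = 2 * \<psi> - pi"
  \<comment> \<open>Half the distance from |\<theta>| to pi: the growth rates of the weight and of
    the Kummer series must add up to less than pi, the bound up to which two Gamma factors absorb
    exponential growth.\<close>
  define \<epsilon> where "\<epsilon> = (pi - \<bar>\<theta>\<bar>) / 2"
  have "\<bar>\<theta>\<bar> < pi" using \<psi> by (auto simp: \<theta>_def)
  hence \<epsilon>: "\<epsilon> > 0" "\<bar>\<theta>\<bar> + \<epsilon> < pi" by (simp_all add: \<epsilon>_def field_simps)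
  define f where "f n x = W x * of_real (exp (\<theta> * x)) *
     (pochhammer (of_real l - \<i> * of_real x) n / pochhammer (of_real (2 * l)) n * (z ^ n / fact n))" for n x
  have l2: "2 * l > 0" using l by simp
  obtain K where K: "K \<ge> 0" "\<And>a N. (\<Sum>n<N. norm (pochhammer a n / pochhammer (of_real (2 * l)) n * (z ^ n / fact n))) \<le> K * exp (\<epsilon> * norm a)"
    using kummer_series_bound[OF l2 \<epsilon>(1), of z] by blast
  \<comment> \<open>The majorant: |l - ix| \<le> l + |x| splits the bound K exp (\<epsilon> |a|)
    into the constant K exp (\<epsilon> l) and a factor exp (\<epsilon> |x|).\<close>
  define w where "w x = K * exp (\<epsilon> * l) * (norm (W x) * exp ((\<bar>\<theta>\<bar> + \<epsilon>) * \<bar>x\<bar>))" for x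
  have int: "integrable lborel w"
    unfolding w_def W_def using Gamma_mult_exp_integrable[of "l + real j" l "\<bar>\<theta>\<bar> + \<epsilon>"] l \<epsilon> by simp
  have bound: "(\<Sum>n<N. norm (f n x)) \<le> w x" for N x
  proof -
    have "norm (of_real l - \<i> * of_real x) \<le> l + \<bar>x\<bar>"
      using l by (intro order_trans[OF norm_triangle_ineq4]) (simp add: norm_mult)
    hence "exp (\<epsilon> * norm (of_real l - \<i> * of_real x)) \<le> exp (\<epsilon> * (l + \<bar>x\<bar>))"
      using \<epsilon> by simp
    hence *: "(\<Sum>n<N. norm (pochhammer (of_real l - \<i> * of_real x) n / pochhammer (of_real (2 * l)) n * (z ^ n / fact n)))
        \<le> K * exp (\<epsilon> * (l + \<bar>x\<bar>))"
      using K by (meson mult_left_mono order_trans)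
    have "\<theta> * x \<le> \<bar>\<theta>\<bar> * \<bar>x\<bar>" by (simp flip: abs_mult)
    hence "(\<Sum>n<N. norm (f n x)) \<le> (norm (W x) * exp (\<bar>\<theta>\<bar> * \<bar>x\<bar>)) * (K * exp (\<epsilon> * (l + \<bar>x\<bar>)))"
      unfolding f_def norm_mult[of "_ * _" "_ / _ * _"] sum_distrib_left[symmetric]
      by (intro mult_mono *) (auto simp: norm_mult intro!: mult_left_mono sum_nonneg)
    also have "\<dots> = w x"
      by (simp add: w_def distrib_left distrib_right exp_add)
    finally show ?thesis .
  qed
  have sums: "(\<lambda>n. f n x) sums g x" for x
    using hypergeom_1F1_sums[of "2 * l" "of_real l - \<i> * of_real x" z] l
    unfolding f_def g_def W_def \<theta>_def by (intro sums_mult) simp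
  have meas: "f n \<in> borel_measurable lborel" for n
    unfolding f_def[abs_def] W_def using l pochhammer_of_real_nonzero[OF l2, of n, where ?'a = complex]
    by (auto intro!: borel_measurable_continuous_onI continuous_intros simp del: of_real_add)
  show "integrable lborel g"
    by (rule integrable_sums_dominated[OF meas int bound sums])
  have "(\<lambda>n. integral\<^sup>L lborel (f n)) sums integral\<^sup>L lborel g"
    by (rule integral_sums_dominated[OF meas int bound sums])
  moreover have "integral\<^sup>L lborel (f n) = of_real (2 * pi * Gamma (2 * l) / (2 * sin \<psi>) powr (2 * l)) * pochhammer (2 * of_real l) (j + n)
       * (1 / (1 - exp (- 2 * \<i> * of_real \<psi>))) ^ j * (1 / (1 - exp (2 * \<i> * of_real \<psi>))) ^ n
       * (z ^ n / (pochhammer (2 * of_real l) n * fact n))" for n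
  proof -
    have "f n = (\<lambda>x. Gamma (of_real (l + real j) + \<i> * of_real x) * Gamma (of_real (l + real n) - \<i> * of_real x) * of_real (exp ((2 * \<psi> - pi) * x))
       * (z ^ n / (pochhammer (2 * of_real l) n * fact n)))"
      by (simp only: Gamma_pochhammer(2)[OF l, symmetric] f_def[abs_def] W_def \<theta>_def) (simp add: mult_ac)
    thus ?thesis
      using has_bochner_integral_integral_eq[OF Gamma_mult_exp_moment[OF l \<psi>, of j n]]
      by (simp only: integral_mult_left_zero)
  qed
  ultimately show "(\<lambda>n. of_real (2 * pi * Gamma (2 * l) / (2 * sin \<psi>) powr (2 * l)) * pochhammer (2 * of_real l) (j + n)
       * (1 / (1 - exp (- 2 * \<i> * of_real \<psi>))) ^ j * (1 / (1 - exp (2 * \<i> * of_real \<psi>))) ^ n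
       * (z ^ n / (pochhammer (2 * of_real l) n * fact n))) sums integral\<^sup>L lborel g"
    by simp
qed

text \<open>The finite sum over j is taken inside the series over n. For fixed n the powers (1 /
  p)^j of the moments cancel the p^j of the polynomial, since weight and polynomial share the angle
  \<psi>. A hypergeometric sum at 1 remains, with Chu-Vandermonde value (-n)_k / (2l)_k, and
  \<open>pochhammer_neg_exp_sums\<close> sums over n.\<close>

lemma meixner_pollaczek_kummer_integral:
  fixes l \<psi> :: real and k :: nat and z :: complex
  assumes l: "l > 0" and \<psi>: "\<psi> \<in> {0<..<pi}"
  defines "y \<equiv> z / (1 - exp (2 * \<i> * of_real \<psi>))"
  shows "has_bochner_integral lborel
    (\<lambda>x. hypergeom [of_real l - \<i> * of_real x] [2 * of_real l] z * of_real (exp ((2 * \<psi> - pi) * x)) *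
       of_real ((cmod (Gamma (of_real l + \<i> * of_real x)))\<^sup>2) * meixner_pollaczek k l (of_real x) \<psi>)
    (of_real (2 * pi * Gamma (2 * l) / (2 * sin \<psi>) powr (2 * l)) * exp (\<i> * of_nat k * of_real \<psi>) * (- y) ^ k * exp y / fact k)"
proof -
  let ?c = "2 * complex_of_real l"
  define M where "M = complex_of_real (2 * pi * Gamma (2 * l) / (2 * sin \<psi>) powr (2 * l))"
  define p where "p = 1 - exp (- 2 * \<i> * of_real \<psi>)"
  define A where "A = pochhammer ?c k / fact k * exp (\<i> * of_nat k * of_real \<psi>)"
  define d where "d j = pochhammer (- of_nat k) j / pochhammer ?c j * (p ^ j / fact j)" for j
  define g where "g j x = Gamma (of_real (l + real j) + \<i> * of_real x) * Gamma (of_real l - \<i> * of_real x) * of_real (exp ((2 * \<psi> - pi) * x))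
      * hypergeom [of_real l - \<i> * of_real x] [?c] z" for j and x :: real
  have c0: "pochhammer ?c n \<noteq> 0" for n
    using pochhammer_of_real_nonzero[of "2 * l" n, where ?'a = complex] l by simp
  have p0: "p \<noteq> 0"
  proof
    assume "p = 0"
    hence "Re (exp (- 2 * \<i> * of_real \<psi>)) = 1" by (simp add: p_def)
    hence "cos (2 * \<psi>) = 1" by (simp add: Re_exp)
    moreover have "sin \<psi> > 0" using \<psi> by (intro sin_gt_zero) auto
    ultimately show False by (simp add: cos_double_sin)
  qed
  have g: "integrable lborel (g j)"
    "(\<lambda>n. M * pochhammer ?c (j + n) * (1 / p) ^ j * (1 / (1 - exp (2 * \<i> * of_real \<psi>))) ^ n
       * (z ^ n / (pochhammer ?c n * fact n))) sums integral\<^sup>L lborel (g j)" for j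
    unfolding g_def[abs_def] M_def p_def using Gamma_mult_kummer_integral[OF l \<psi>, of j z] by auto
  have "hypergeom [of_real l - \<i> * of_real x] [?c] z * of_real (exp ((2 * \<psi> - pi) * x)) *
       of_real ((cmod (Gamma (of_real l + \<i> * of_real x)))\<^sup>2) * meixner_pollaczek k l (of_real x) \<psi>
      = A * (\<Sum>j\<le>k. d j * g j x)" for x
  proof -
    have "of_real ((cmod (Gamma (of_real l + \<i> * of_real x)))\<^sup>2)
        = Gamma (of_real l + \<i> * of_real x) * Gamma (of_real l - \<i> * of_real x)"
      unfolding complex_norm_square by (simp add: cnj_Gamma)
    thus ?thesis
      by (simp only: meixner_pollaczek_altdef g_def Gamma_pochhammer(1)[OF l, symmetric] A_def d_def p_def)
         (simp add: sum_distrib_left mult_ac)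
  qed
  moreover have "has_bochner_integral lborel (\<lambda>x. A * (\<Sum>j\<le>k. d j * g j x)) (A * (\<Sum>j\<le>k. d j * integral\<^sup>L lborel (g j)))"
    using g(1) by (intro has_bochner_integral_mult_right has_bochner_integral_sum has_bochner_integral_integrable) auto
  moreover have "A * (\<Sum>j\<le>k. d j * integral\<^sup>L lborel (g j)) = M * exp (\<i> * of_nat k * of_real \<psi>) * (- y) ^ k * exp y / fact k"
  proof -
    have "(\<lambda>n. \<Sum>j\<le>k. d j * (M * pochhammer ?c (j + n) * (1 / p) ^ j * (1 / (1 - exp (2 * \<i> * of_real \<psi>))) ^ n
       * (z ^ n / (pochhammer ?c n * fact n)))) sums (\<Sum>j\<le>k. d j * integral\<^sup>L lborel (g j))"
      by (intro sums_sum sums_mult g(2))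
    moreover have "(\<Sum>j\<le>k. d j * (M * pochhammer ?c (j + n) * (1 / p) ^ j * (1 / (1 - exp (2 * \<i> * of_real \<psi>))) ^ n
       * (z ^ n / (pochhammer ?c n * fact n)))) = M / pochhammer ?c k * (pochhammer (- of_nat n) k * y ^ n / fact n)" for n
    proof -
      have "(\<Sum>j\<le>k. d j * (M * pochhammer ?c (j + n) * (1 / p) ^ j * (1 / (1 - exp (2 * \<i> * of_real \<psi>))) ^ n
         * (z ^ n / (pochhammer ?c n * fact n))))
        = (\<Sum>j\<le>k. M * (y ^ n / fact n) * (pochhammer (?c + of_nat n) j * pochhammer (- of_nat k) j / (of_nat (fact j) * pochhammer ?c j)))"
      proof (intro sum.cong refl)
        fix j
        \<comment> \<open>The factor (2l)_n cancels the denominator of the Kummer series, while (2l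
          + n)_j supplies a numerator parameter for Chu-Vandermonde.\<close>
        have "pochhammer ?c (j + n) = pochhammer ?c n * pochhammer (?c + of_nat n) j"
          by (simp add: add.commute[of j] pochhammer_product')
        thus "d j * (M * pochhammer ?c (j + n) * (1 / p) ^ j * (1 / (1 - exp (2 * \<i> * of_real \<psi>))) ^ n
         * (z ^ n / (pochhammer ?c n * fact n)))
          = M * (y ^ n / fact n) * (pochhammer (?c + of_nat n) j * pochhammer (- of_nat k) j / (of_nat (fact j) * pochhammer ?c j))"
          using c0 p0 by (simp add: d_def y_def power_divide mult_ac)
      qed
      also have "\<dots> = M * (y ^ n / fact n) * (pochhammer (?c - (?c + of_nat n)) k / pochhammer ?c k)"
        unfolding sum_distrib_left[symmetric] atMost_atLeast0
        by (subst Vandermonde_pochhammer) (use l in \<open>auto simp: complex_eq_iff\<close>)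
      finally show ?thesis by (simp add: mult_ac)
    qed
    ultimately have "(\<lambda>n. M / pochhammer ?c k * (pochhammer (- of_nat n) k * y ^ n / fact n)) sums (\<Sum>j\<le>k. d j * integral\<^sup>L lborel (g j))"
      by simp
    moreover have "(\<lambda>n. M / pochhammer ?c k * (pochhammer (- of_nat n) k * y ^ n / fact n)) sums (M / pochhammer ?c k * ((- y) ^ k * exp y))"
      by (intro sums_mult pochhammer_neg_exp_sums)
    ultimately have "(\<Sum>j\<le>k. d j * integral\<^sup>L lborel (g j)) = M / pochhammer ?c k * ((- y) ^ k * exp y)"
      by (rule sums_unique2)
    \<comment> \<open>The normalising factor (2l)_k in \<open>A\<close> cancels the denominator left
      by Chu-Vandermonde.\<close>
    thus ?thesis using c0[of k] by (simp add: A_def)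
  qed
  ultimately show ?thesis unfolding M_def by simp
qed

text \<open>Kummer's transformation brings the integrand to the form of the preceding lemma. The
  remaining trigonometric identities for y and for the exponent are checked as rational identities
  in E = exp (i \<psi>) and D = exp (i \<phi>).\<close>

theorem corollary6p9:
  fixes k :: nat and l \<psi> \<phi> :: real and \<rho> :: complex
  assumes "l > 0" and "\<psi> \<in> {0<..<pi}" and "\<phi> \<in> {0<..<pi}"
  shows "has_bochner_integral lborel
    (\<lambda>x::real.
       exp \<rho> *
       hypergeom [of_real l + \<i> * of_real x] [2 * of_real l] ((exp (- 2 * \<i> * of_real \<phi>) - 1) * \<rho>) *
       of_real (exp ((2 * \<psi> - pi) * x)) *
       of_real ((cmod (Gamma (of_real l + \<i> * of_real x)))\<^sup>2) *
       meixner_pollaczek k l (of_real x) \<psi>)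
    (exp (\<rho> * exp (- \<i> * of_real \<phi>) * of_real (sin (\<psi> - \<phi>)) / of_real (sin \<psi>)) *
     of_real (sin \<phi> / sin \<psi>) ^ k *
     (2 * of_real pi * of_real (Gamma (2 * l)) * \<rho> ^ k /
      (exp (\<i> * of_nat k * of_real \<phi>) * of_real ((2 * sin \<psi>) powr (2 * l)) * fact k)))"
proof -
  have sin: "sin \<psi> > 0" using assms by (intro sin_gt_zero) auto
  \<comment> \<open>The negative of the argument in the claim, so that Kummer's transformation
    produces a series in z.\<close>
  define z where "z = (1 - exp (- 2 * \<i> * of_real \<phi>)) * \<rho>"
  define y where "y = z / (1 - exp (2 * \<i> * of_real \<psi>))"
  define E where "E = iexp \<psi>"
  define D where "D = iexp \<phi>"
  have nz: "E \<noteq> 0" "D \<noteq> 0" by (simp_all add: E_def D_def)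
  have exps: "exp (2 * \<i> * of_real \<psi>) = E ^ 2" "exp (- 2 * \<i> * of_real \<phi>) = 1 / D ^ 2"
    "exp (- \<i> * of_real \<phi>) = 1 / D"
    by (simp_all add: E_def D_def exp_minus inverse_eq_divide mult.assoc flip: exp_double)
  have sins: "of_real (sin t) = (iexp t - 1 / iexp t) / (2 * \<i>)" for t
    unfolding sin_of_real[symmetric] sin_exp_eq exp_minus inverse_eq_divide ..
  have s\<psi>: "of_real (sin \<psi>) = (E\<^sup>2 - 1) / (2 * \<i> * E)" and s\<phi>: "of_real (sin \<phi>) = (D\<^sup>2 - 1) / (2 * \<i> * D)"
    unfolding sins E_def[symmetric] D_def[symmetric] using nz by (simp_all add: field_simps power2_eq_square)
  have ED: "iexp (\<psi> - \<phi>) = E / D"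
    by (simp add: E_def D_def right_diff_distrib exp_diff)
  have s\<psi>\<phi>: "of_real (sin (\<psi> - \<phi>)) = (E\<^sup>2 - D\<^sup>2) / (2 * \<i> * E * D)"
    unfolding sins ED using nz by (simp add: field_simps power2_eq_square)
  have E1: "E\<^sup>2 \<noteq> 1"
    using s\<psi> sin by auto
  have "- y = \<rho> * (D\<^sup>2 - 1) / (D\<^sup>2 * (E\<^sup>2 - 1))"
    using nz E1 unfolding y_def z_def exps by (simp add: divide_simps) (simp add: algebra_simps)
  moreover have "\<rho> * of_real (sin \<phi> / sin \<psi>) / (E * D) = \<rho> * (D\<^sup>2 - 1) / (D\<^sup>2 * (E\<^sup>2 - 1))"
    unfolding of_real_divide s\<psi> s\<phi> using nz E1 by (simp add: divide_simps power2_eq_square)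
  \<comment> \<open>In the k-th power, 1 / E^k cancels the phase exp (i k \<psi>) of the integral
    and 1 / D^k supplies exp (-i k \<phi>).\<close>
  ultimately have y: "- y = \<rho> * of_real (sin \<phi> / sin \<psi>) / (E * D)"
    by simp
  \<comment> \<open>Three exponents meet: \<rho> from the prefactor, -z from Kummer's transformation
    and y from the sum over n.\<close>
  have "\<rho> + - z + y = \<rho> * (E\<^sup>2 - D\<^sup>2) / (D\<^sup>2 * (E\<^sup>2 - 1))"
    using nz E1 unfolding y_def z_def exps by (simp add: divide_simps) (simp add: algebra_simps)
  moreover have "\<rho> * exp (- \<i> * of_real \<phi>) * of_real (sin (\<psi> - \<phi>)) / of_real (sin \<psi>)
      = \<rho> * (E\<^sup>2 - D\<^sup>2) / (D\<^sup>2 * (E\<^sup>2 - 1))"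
    unfolding s\<psi> s\<psi>\<phi> exps using nz E1 by (simp add: divide_simps power2_eq_square)
  ultimately have expo: "\<rho> + - z + y = \<rho> * exp (- \<i> * of_real \<phi>) * of_real (sin (\<psi> - \<phi>)) / of_real (sin \<psi>)"
    by simp
  have kummer: "hypergeom [of_real l + \<i> * of_real x] [2 * of_real l] ((exp (- 2 * \<i> * of_real \<phi>) - 1) * \<rho>)
     = exp (- z) * hypergeom [of_real l - \<i> * of_real x] [2 * of_real l] z" for x :: real
    using kummer_transformation[of "2 * l" "of_real l + \<i> * of_real x" "- z"] assms(1)
    by (simp add: z_def algebra_simps)
  have pw: "exp (\<i> * of_nat k * of_real \<psi>) = E ^ k" "exp (\<i> * of_nat k * of_real \<phi>) = D ^ k"
    by (simp_all add: E_def D_def mult_ac flip: exp_of_nat_mult)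
  have "has_bochner_integral lborel
    (\<lambda>x. exp \<rho> * exp (- z) * (hypergeom [of_real l - \<i> * of_real x] [2 * of_real l] z * of_real (exp ((2 * \<psi> - pi) * x)) *
       of_real ((cmod (Gamma (of_real l + \<i> * of_real x)))\<^sup>2) * meixner_pollaczek k l (of_real x) \<psi>))
    (exp \<rho> * exp (- z) * (of_real (2 * pi * Gamma (2 * l) / (2 * sin \<psi>) powr (2 * l)) *
       exp (\<i> * of_nat k * of_real \<psi>) * (- y) ^ k * exp y / fact k))"
    unfolding y_def by (intro has_bochner_integral_mult_right meixner_pollaczek_kummer_integral assms)
  moreover have "exp \<rho> * exp (- z) * (of_real (2 * pi * Gamma (2 * l) / (2 * sin \<psi>) powr (2 * l)) *
       exp (\<i> * of_nat k * of_real \<psi>) * (- y) ^ k * exp y / fact k)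
    = exp (\<rho> + - z + y) * of_real (sin \<phi> / sin \<psi>) ^ k *
     (2 * of_real pi * of_real (Gamma (2 * l)) * \<rho> ^ k /
      (exp (\<i> * of_nat k * of_real \<phi>) * of_real ((2 * sin \<psi>) powr (2 * l)) * fact k))"
    using nz unfolding pw y exp_add
    by (simp add: power_divide power_mult_distrib mult_ac)
  ultimately show ?thesis
    unfolding kummer expo by (simp add: mult.assoc)
qed

end
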